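(* Fix $h>0$ and let $\beta>\beta_c(h)>0$. Then, for any $\eta>0$, $$\lim_{n\to+\infty}\mathbb{E}\left[\mathcal{G}_{\beta,h,n}\{|y_n(\sigma)-m^*|>\eta\}\right]=0.$$ More precisely, there exist $c=c(\beta,h,\eta)>0$ and $C=C(\beta,h,\eta)<+\infty$ such that $$\mathbb{E}\left[\mathcal{G}_{\beta,h,n}\{|y_n(\sigma)-m^*|>\eta\}\right]\le C e^{-cn},\qquad \forall n\ge 1,$$ which implies $$\lim_{n\to\infty}\mathcal{G}_{\beta,h,n}\{|y_n(\sigma)-m^*|>\eta\}=0\quad\text{almost surely}.$$
   Context: For $n\ge1$ let $\Sigma_n=\{-1,1\}^n$; for $\sigma=(\sigma_1,\dots,\sigma_n)\in\Sigma_n$ and $1\le i\le n$ let $\sigma|_i=(\sigma_1,\dots,\sigma_i)\in\Sigma_i$. Let $(U(v))_{v\in\bigcup_{n\ge1}\Sigma_n}$ be i.i.d. standard Gaussian random variables on a probability space with probability $\mathbb{P}$ and expectation $\mathbb{E}$. For $\sigma\in\Sigma_n$ and $h>0$ set $$X_n(\sigma)=\sum_{i=1}^nU(\sigma|_i),\qquad H_n(\sigma,h)=X_n(\sigma)+h\sum_{i=1}^n\sigma_i.$$ For $\beta>0$ the partition function is $Z_{\beta,h,n}=\sum_{\sigma\in\Sigma_n}e^{\beta H_n(\sigma,h)}$, and the (random) Gibbs measure on $\Sigma_n$ is $\mathcal{G}_{\beta,h,n}(\sigma)=e^{\beta H_n(\sigma,h)}/Z_{\beta,h,n}$; $\mathcal{G}_{\beta,h,n}\{\cdot\}$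 denotes the Gibbs probability of an event depending on $\sigma$. Let $\psi_h(t)=\frac{t^2}{2}+\log2+\log(\cosh(ht))$ for $t\in\mathbb{R}$, and let $\beta_c=\beta_c(h)>0$ be the unique positive real number with $\beta_c\psi_h'(\beta_c)-\psi_h(\beta_c)=0$. The empirical magnetization is $y_n(\sigma)=\frac1n\sum_{i=1}^n\sigma_i$, and $m^*=m^*(h)=\tanh(\beta_c(h)\,h)$. *)

theory Defs
  imports "HOL-Probability.Probability"
begin

definition configs :: "nat \<Rightarrow> int list set" where
  "configs n = {\<sigma>. length \<sigma> = n \<and> set \<sigma> \<subseteq> {-1, 1}}"

definition vertices :: "int list set" where
  "vertices = (\<Union>n\<in>{1..}. configs n)"

locale gaussian_tree = prob_space M for M :: "'w measure" +
  fixes U :: "int list \<Rightarrow> 'w \<Rightarrow> real"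
  assumes indep_U: "indep_vars (\<lambda>_. borel) U vertices"
    and distributed_U: "\<And>v. v \<in> vertices \<Longrightarrow> distributed M lborel (U v) std_normal_density"

text \<open>In the following definitions, \<open>u\<close> is a single realization of the disorder, and the
  restriction of a configuration to its first \<open>i\<close> spins is \<open>take i \<sigma>\<close>. Spins are
  indexed from \<open>0\<close>.\<close>

definition X :: "(int list \<Rightarrow> real) \<Rightarrow> nat \<Rightarrow> int list \<Rightarrow> real" where
  "X u n \<sigma> = (\<Sum>i=1..n. u (take i \<sigma>))"

definition H :: "(int list \<Rightarrow> real) \<Rightarrow> real \<Rightarrow> nat \<Rightarrow> int list \<Rightarrow> real" where
  "H u h n \<sigma> = X u n \<sigma> + h * (\<Sum>i<n. real_of_int (\<sigma> ! i))"

definition Z :: "(int list \<Rightarrow> real) \<Rightarrow> real \<Rightarrow> real \<Rightarrow> nat \<Rightarrow> real" where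
  "Z u \<beta> h n = (\<Sum>\<sigma>\<in>configs n. exp (\<beta> * H u h n \<sigma>))"

definition gibbs_weight ::
  "(int list \<Rightarrow> real) \<Rightarrow> real \<Rightarrow> real \<Rightarrow> nat \<Rightarrow> int list \<Rightarrow> real" where
  "gibbs_weight u \<beta> h n \<sigma> = exp (\<beta> * H u h n \<sigma>) / Z u \<beta> h n"

definition gibbs ::
  "(int list \<Rightarrow> real) \<Rightarrow> real \<Rightarrow> real \<Rightarrow> nat \<Rightarrow> (int list \<Rightarrow> bool) \<Rightarrow> real" where
  "gibbs u \<beta> h n P = (\<Sum>\<sigma>\<in>{\<sigma> \<in> configs n. P \<sigma>}. gibbs_weight u \<beta> h n \<sigma>)"

definition magnetization :: "nat \<Rightarrow> int list \<Rightarrow> real" where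
  "magnetization n \<sigma> = (\<Sum>i<n. real_of_int (\<sigma> ! i)) / real n"

definition psi :: "real \<Rightarrow> real \<Rightarrow> real" where
  "psi h t = t\<^sup>2 / 2 + ln 2 + ln (cosh (h * t))"

definition beta_c :: "real \<Rightarrow> real" where
  "beta_c h = (THE b. b > 0 \<and> b * deriv (psi h) b - psi h b = 0)"

definition m_star :: "real \<Rightarrow> real" where
  "m_star h = tanh (beta_c h * h)"

end

theory Submission
  imports Defs
begin

text \<open>Write \<open>\<beta>\<^sub>c\<close> for the critical inverse temperature. A configuration of atypical magnetization is
  suppressed at \<open>\<beta>\<^sub>c\<close> already: weighting spins by an additional small field \<open>\<plusminus>\<lambda>\<close> shows that the
  sum over these configurations of \<open>exp (\<beta>\<^sub>c H)\<close> has expectation at most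
  \<open>exp (n (\<psi> \<beta>\<^sub>c - 2 \<delta>))\<close>, because the mean magnetization of the weights
  \<open>exp (\<beta>\<^sub>c h \<sigma>\<^sub>i)\<close> is exactly the tanh that defines the limit (\<open>exists_tilt\<close>,
  \<open>restricted_sum_le_tilted_Z\<close>). By Markov's inequality this sum is at most
  \<open>exp (n (\<psi> \<beta>\<^sub>c - \<delta>))\<close> up to an exponentially small probability, and since \<open>\<beta> \<ge> \<beta>\<^sub>c\<close>,
  comparing power sums bounds the sum of \<open>exp (\<beta> H)\<close> over the same configurations by
  \<open>exp (n \<beta> / \<beta>\<^sub>c (\<psi> \<beta>\<^sub>c - \<delta>))\<close>.

  It remains to see that the full partition function at \<open>\<beta>\<close> is exponentially larger, that is, that its free
  energy is at least \<open>\<beta> / \<beta>\<^sub>c \<psi> \<beta>\<^sub>c\<close> up to a small error. The free energy is convex in \<open>\<beta>\<close>, and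
  \<open>\<beta> / \<beta>\<^sub>c \<psi> \<beta>\<^sub>c\<close> is the value at \<open>\<beta>\<close> of the tangent to \<open>\<psi>\<close> at \<open>\<beta>\<^sub>c\<close>, by the equation
  that defines \<open>\<beta>\<^sub>c\<close>. So a lower bound on Z at some \<open>b < \<beta>\<^sub>c\<close> and an upper bound at some
  \<open>b' < b\<close>, both close to \<open>\<beta>\<^sub>c\<close>, are enough (\<open>Z_ge_of_tangent_slope\<close>). The upper
  bound is the first moment. The lower bound (\<open>Z_lower_deviation\<close>) has two ingredients. For \<open>b < \<beta>\<^sub>c\<close> the
  normalized partition function is bounded in \<open>L\<^sup>p\<close> for some \<open>p > 1\<close>
  (\<open>normalized_Z_moment_bounded\<close>), hence is at least 1/2 with a probability bounded below. Applied to the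
  \<open>2 ^ k\<close> independent subtrees that hang below level k, with k a small multiple of n, this makes it
  overwhelmingly likely that one of them has a partition function of the typical size, and the path that leads to it
  costs only a factor \<open>exp (- const * k)\<close>.

  All probabilistic estimates are proved for every Gaussian tree at once, with constants that depend only on the
  parameters. A subtree of a Gaussian tree is a Gaussian tree (\<open>subtree\<close>), so inductions over the depth apply
  the hypothesis to the two subtrees of the root; equality in law is never needed.\<close>

section \<open>The recursive structure of the tree\<close>

lemma configs_0 [simp]: "configs 0 = {[]}"
  by (auto simp: configs_def)

lemma Nil_in_configs_iff [simp]: "[] \<in> configs n \<longleftrightarrow> n = 0"
  by (auto simp: configs_def)

lemma Cons_in_configs_iff [simp]:
  "s # \<sigma> \<in> configs (Suc n) \<longleftrightarrow> s \<in> {-1, 1} \<and> \<sigma> \<in> configs n"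
  by (auto simp: configs_def)

lemma configs_Suc: "configs (Suc n) = (#) (-1) ` configs n \<union> (#) 1 ` configs n"
proof (rule set_eqI)
  fix \<sigma> :: "int list"
  show "\<sigma> \<in> configs (Suc n) \<longleftrightarrow> \<sigma> \<in> (#) (-1) ` configs n \<union> (#) 1 ` configs n"
    by (cases \<sigma>) auto
qed

lemma finite_configs [simp]: "finite (configs n)"
  by (induction n) (auto simp: configs_Suc)

lemma configs_nonempty: "configs n \<noteq> {}"
  by (induction n) (auto simp: configs_Suc)

lemma sum_configs_Suc:
  fixes f :: "int list \<Rightarrow> real"
  shows "(\<Sum>\<sigma>\<in>configs (Suc n). f \<sigma>) = (\<Sum>s\<in>{-1, 1}. \<Sum>\<sigma>\<in>configs n. f (s # \<sigma>))"
proof -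
  have "(\<Sum>\<sigma>\<in>configs (Suc n). f \<sigma>)
      = (\<Sum>\<sigma>\<in>(#) (-1) ` configs n. f \<sigma>) + (\<Sum>\<sigma>\<in>(#) 1 ` configs n. f \<sigma>)"
    unfolding configs_Suc by (rule sum.union_disjoint) auto
  then show ?thesis
    by (simp add: sum.reindex)
qed

lemma prod_configs_Suc:
  fixes f :: "int list \<Rightarrow> real"
  shows "(\<Prod>\<sigma>\<in>configs (Suc n). f \<sigma>) = (\<Prod>s\<in>{-1, 1}. \<Prod>\<sigma>\<in>configs n. f (s # \<sigma>))"
proof -
  have "(\<Prod>\<sigma>\<in>configs (Suc n). f \<sigma>)
      = (\<Prod>\<sigma>\<in>(#) (-1) ` configs n. f \<sigma>) * (\<Prod>\<sigma>\<in>(#) 1 ` configs n. f \<sigma>)"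
    unfolding configs_Suc by (rule prod.union_disjoint) auto
  then show ?thesis
    by (simp add: prod.reindex)
qed

lemma Cons_in_vertices: "v \<in> vertices \<Longrightarrow> s \<in> {-1, 1} \<Longrightarrow> s # v \<in> vertices"
  by (auto simp: vertices_def configs_def)

lemma singleton_in_vertices: "s \<in> {-1, 1} \<Longrightarrow> [s] \<in> vertices"
  by (auto simp: vertices_def configs_def)

lemma take_in_vertices:
  assumes "\<sigma> \<in> configs n" "i \<in> {1..n}"
  shows "take i \<sigma> \<in> vertices"
  using assms by (auto simp: vertices_def configs_def dest: in_set_takeD)

lemma H_Cons:
  "H u h (Suc n) (s # \<sigma>) = u [s] + h * real_of_int s + H (\<lambda>v. u (s # v)) h n \<sigma>"
proof -
  have "X u (Suc n) (s # \<sigma>) = (\<Sum>i=0..n. u (take (Suc i) (s # \<sigma>)))"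
    unfolding X_def by (subst sum.shift_bounds_cl_Suc_ivl[symmetric]) simp
  also have "\<dots> = u [s] + X (\<lambda>v. u (s # v)) n \<sigma>"
    unfolding X_def by (simp add: sum.atLeast_Suc_atMost)
  finally show ?thesis
    unfolding H_def by (simp add: sum.lessThan_Suc_shift algebra_simps del: sum.lessThan_Suc)
qed

lemma Z_0 [simp]: "Z u b h 0 = 1"
  by (simp add: Z_def H_def X_def)

text \<open>Splitting off the first spin expresses Z through the partition functions of the two subtrees of the root. All
  inductions over the depth rest on this identity.\<close>

lemma Z_Suc:
  "Z u b h (Suc n) =
    (\<Sum>s\<in>{-1, 1}. exp (b * (u [s] + h * real_of_int s)) * Z (\<lambda>v. u (s # v)) b h n)"
  unfolding Z_def sum_configs_Suc
  by (simp add: H_Cons sum_distrib_left distrib_left exp_add mult.assoc)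

lemma Z_pos: "Z u b h n > 0"
  unfolding Z_def by (intro sum_pos configs_nonempty) auto

text \<open>Keeping only the configurations that start with v. The bound transfers a large partition function of one deep subtree
  to the whole tree.\<close>

lemma Z_ge_subtree:
  assumes "v \<in> configs k"
  shows "exp (b * H u h k v) * Z (\<lambda>w. u (v @ w)) b h m \<le> Z u b h (k + m)"
  using assms
proof (induction k arbitrary: u v)
  case 0
  then show ?case by (simp add: H_def X_def)
next
  case (Suc k)
  then obtain s w where v: "v = s # w" and s: "s \<in> {-1, 1}" and w: "w \<in> configs k"
    by (cases v) auto
  let ?t = "\<lambda>s. exp (b * (u [s] + h * real_of_int s)) * Z (\<lambda>v. u (s # v)) b h (k + m)"
  have "exp (b * H u h (Suc k) v) * Z (\<lambda>w. u (v @ w)) b h m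
      = exp (b * (u [s] + h * real_of_int s)) *
        (exp (b * H (\<lambda>v. u (s # v)) h k w) * Z (\<lambda>x. u (s # (w @ x))) b h m)"
    by (simp add: v H_Cons distrib_left exp_add)
  also have "\<dots> \<le> ?t s"
    using Suc.IH[OF w, of "\<lambda>v. u (s # v)"] by (intro mult_left_mono) auto
  also have "\<dots> \<le> (\<Sum>s\<in>{-1, 1}. ?t s)"
    using s by (intro member_le_sum) (auto intro!: mult_nonneg_nonneg less_imp_le[OF Z_pos])
  also have "\<dots> = Z u b h (Suc k + m)"
    by (simp add: Z_Suc)
  finally show ?case .
qed

section \<open>Functionals of the disorder and independence of branches\<close>

text \<open>The functional f of the disorder is a measurable function of the coordinates in V alone. Disorders are total functions
  here, whereas the points of the product space are undefined outside V; the second condition bridges the two. It lets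
  two functionals with disjoint sets V be recognized as independent although both take the full disorder as argument.\<close>

definition depends_measurably ::
  "int list set \<Rightarrow> ((int list \<Rightarrow> real) \<Rightarrow> real) \<Rightarrow> bool" where
  "depends_measurably V f \<longleftrightarrow>
    f \<in> borel_measurable (PiM V (\<lambda>_. borel)) \<and> (\<forall>u. f (restrict u V) = f u)"

lemma depends_measurably_const: "depends_measurably V (\<lambda>u. c)"
  by (simp add: depends_measurably_def)

lemma depends_measurably_coordinate: "v \<in> V \<Longrightarrow> depends_measurably V (\<lambda>u. u v)"
  by (simp add: depends_measurably_def)

lemma depends_measurably_compose:
  "g \<in> borel_measurable borel \<Longrightarrow> depends_measurably V f \<Longrightarrow> depends_measurably V (\<lambda>u. g (f u))"
  by (auto simp: depends_measurably_def)

lemma depends_measurably_add: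
  "depends_measurably V f \<Longrightarrow> depends_measurably V g \<Longrightarrow> depends_measurably V (\<lambda>u. f u + g u)"
  by (auto simp: depends_measurably_def)

lemma depends_measurably_mult:
  "depends_measurably V f \<Longrightarrow> depends_measurably V g \<Longrightarrow> depends_measurably V (\<lambda>u. f u * g u)"
  by (auto simp: depends_measurably_def)

lemma depends_measurably_mono:
  assumes "depends_measurably V f" "V \<subseteq> V'"
  shows "depends_measurably V' f"
proof -
  have eq: "f (restrict u V) = f u" for u
    using assms(1) by (simp add: depends_measurably_def)
  have "(\<lambda>u. f (restrict u V)) \<in> borel_measurable (PiM V' (\<lambda>_. borel))"
    using assms by (intro measurable_compose[OF measurable_restrict_subset])
                   (auto simp: depends_measurably_def)
  moreover have "f (restrict u V') = f u" for u
    using eq[of "restrict u V'"] eq[of u] assms(2) by (simp add: Int_absorb1)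
  ultimately show ?thesis
    by (simp add: depends_measurably_def eq)
qed

lemma depends_measurably_shift:
  assumes "depends_measurably V f"
  shows "depends_measurably ((#) s ` V) (\<lambda>u. f (\<lambda>v. u (s # v)))"
proof -
  have eq: "f (restrict u V) = f u" for u
    using assms by (simp add: depends_measurably_def)
  have "(\<lambda>u. \<lambda>v\<in>V. u (s # v)) \<in> measurable (PiM ((#) s ` V) (\<lambda>_. borel)) (PiM V (\<lambda>_. borel :: real measure))"
    by (rule measurable_restrict, rule measurable_component_singleton) simp
  from measurable_compose[OF this, of f borel] have "(\<lambda>u. f (\<lambda>v\<in>V. u (s # v))) \<in> borel_measurable (PiM ((#) s ` V) (\<lambda>_. borel))"
    using assms unfolding depends_measurably_def by blast
  moreover have "f (\<lambda>v. restrict u ((#) s ` V) (s # v)) = f (\<lambda>v. u (s # v))" for u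
  proof -
    have "(\<lambda>v\<in>V. restrict u ((#) s ` V) (s # v)) = (\<lambda>v\<in>V. u (s # v))"
      by (auto simp: fun_eq_iff)
    then show ?thesis
      using eq[of "\<lambda>v. restrict u ((#) s ` V) (s # v)"] eq[of "\<lambda>v. u (s # v)"] by simp
  qed
  ultimately show ?thesis
    by (simp add: depends_measurably_def eq)
qed

text \<open>Unlike the subtree alone, a branch contains its first vertex, so that the two branches partition the vertices.\<close>

definition branch :: "int \<Rightarrow> int list set" where
  "branch s = insert [s] ((#) s ` vertices)"

lemma branch_subset_vertices: "s \<in> {-1, 1} \<Longrightarrow> branch s \<subseteq> vertices"
  using Cons_in_vertices singleton_in_vertices by (auto simp: branch_def)

lemma branch_disjoint: "s \<noteq> t \<Longrightarrow> branch s \<inter> branch t = {}"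
  by (auto simp: branch_def)

lemma depends_measurably_subtree:
  "depends_measurably vertices f \<Longrightarrow> depends_measurably (branch s) (\<lambda>u. f (\<lambda>v. u (s # v)))"
  by (rule depends_measurably_mono[OF depends_measurably_shift]) (auto simp: branch_def)

lemma depends_measurably_root: "depends_measurably (branch s) (\<lambda>u. u [s])"
  by (rule depends_measurably_coordinate) (simp add: branch_def)

lemma depends_measurably_branch:
  "s \<in> {-1, 1} \<Longrightarrow> depends_measurably (branch s) f \<Longrightarrow> depends_measurably vertices f"
  using depends_measurably_mono branch_subset_vertices by blast

lemma depends_measurably_Z: "depends_measurably vertices (\<lambda>u. Z u b h n)"
proof (induction n)
  case 0
  then show ?case by (simp add: depends_measurably_const)
next
  case (Suc n)
  have "depends_measurably vertices
      (\<lambda>u. exp (b * (u [s] + h * real_of_int s)) * Z (\<lambda>v. u (s # v)) b h n)"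
    if s: "s \<in> {-1, 1}" for s
    by (rule depends_measurably_branch[OF s], rule depends_measurably_mult[OF
          depends_measurably_compose[OF _ depends_measurably_root]
          depends_measurably_subtree[OF Suc.IH]]) measurable
  from depends_measurably_add[OF this[of "-1"] this[of 1]] show ?case
    by (simp add: Z_Suc)
qed

context gaussian_tree
begin

lemma random_variable_U: "v \<in> vertices \<Longrightarrow> U v \<in> borel_measurable M"
  using indep_U by (auto simp: indep_vars_def)

lemma random_variable_functional:
  assumes "depends_measurably V f" "V \<subseteq> vertices"
  shows "(\<lambda>\<omega>. f (\<lambda>v. U v \<omega>)) \<in> borel_measurable M"
proof -
  have "(\<lambda>\<omega>. \<lambda>v\<in>V. U v \<omega>) \<in> measurable M (PiM V (\<lambda>_. borel))"
    using assms(2) random_variable_U by (intro measurable_restrict) auto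
  from measurable_compose[OF this, of f borel] have "(\<lambda>\<omega>. f (\<lambda>v\<in>V. U v \<omega>)) \<in> borel_measurable M"
    using assms(1) by (simp add: depends_measurably_def)
  then show ?thesis
    using assms(1) by (simp add: depends_measurably_def)
qed

lemma indep_var_functionals:
  assumes f: "depends_measurably V f" and g: "depends_measurably W g"
    and VW: "V \<inter> W = {}" "V \<subseteq> vertices" "W \<subseteq> vertices"
  shows "indep_var borel (\<lambda>\<omega>. f (\<lambda>v. U v \<omega>)) borel (\<lambda>\<omega>. g (\<lambda>v. U v \<omega>))"
proof -
  have "indep_var borel (f \<circ> (\<lambda>\<omega>. \<lambda>v\<in>V. U v \<omega>)) borel (g \<circ> (\<lambda>\<omega>. \<lambda>v\<in>W. U v \<omega>))"
    using f g by (intro indep_var_compose[OF indep_var_restrict[OF indep_U VW]])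
                 (auto simp: depends_measurably_def)
  then show ?thesis
    using f g by (simp add: comp_def depends_measurably_def)
qed

text \<open>Reindexing an independent family along the injection that prepends s keeps it independent. Thus a statement proved for
  all Gaussian trees holds for each subtree.\<close>

lemma subtree:
  assumes s: "s \<in> {-1, 1}"
  shows "gaussian_tree M (\<lambda>v. U (s # v))"
proof
  have sub: "(#) s ` vertices \<subseteq> vertices"
    using s Cons_in_vertices by auto
  have "disjoint_family_on (\<lambda>v. {s # v}) vertices"
    by (auto simp: disjoint_family_on_def)
  then have "indep_vars (\<lambda>v. PiM {s # v} (\<lambda>_. borel)) (\<lambda>v \<omega>. \<lambda>i\<in>{s # v}. U i \<omega>) vertices"
    using sub by (intro indep_vars_restrict[OF indep_U]) auto
  then have "indep_vars (\<lambda>_. borel) (\<lambda>v. (\<lambda>x. x (s # v)) \<circ> (\<lambda>\<omega>. \<lambda>i\<in>{s # v}. U i \<omega>)) vertices"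
    by (rule indep_vars_compose) (auto intro!: measurable_component_singleton)
  then show "indep_vars (\<lambda>_. borel) (\<lambda>v. U (s # v)) vertices"
    by (simp add: comp_def)
  show "distributed M lborel (U (s # v)) std_normal_density" if "v \<in> vertices" for v
    using distributed_U Cons_in_vertices[OF that s] by blast
qed

lemma random_variable_Z [measurable]: "(\<lambda>\<omega>. Z (\<lambda>v. U v \<omega>) b h n) \<in> borel_measurable M"
  by (rule random_variable_functional[OF depends_measurably_Z]) simp

text \<open>Completing the square turns the weighted standard normal density into a multiple of the normal density with mean t.\<close>

lemma gaussian_mgf:
  assumes "v \<in> vertices"
  shows "integrable M (\<lambda>\<omega>. exp (t * U v \<omega>))"
    and "expectation (\<lambda>\<omega>. exp (t * U v \<omega>)) = exp (t\<^sup>2 / 2)"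
proof -
  note d = distributed_U[OF assms]
  have shift: "std_normal_density x * exp (t * x) = exp (t\<^sup>2 / 2) * normal_density t 1 x" for x
  proof -
    have "- x\<^sup>2 / 2 + t * x = t\<^sup>2 / 2 + - (x - t)\<^sup>2 / 2"
      by (simp add: power2_eq_square field_simps)
    then show ?thesis
      by (simp add: normal_density_def mult_exp_exp field_simps)
  qed
  show "integrable M (\<lambda>\<omega>. exp (t * U v \<omega>))"
    by (subst distributed_integrable[OF d, symmetric]) (auto simp: shift)
  show "expectation (\<lambda>\<omega>. exp (t * U v \<omega>)) = exp (t\<^sup>2 / 2)"
    by (subst distributed_integral[OF d, symmetric]) (auto simp: shift)
qed

lemma gaussian_exp_affine:
  assumes "v \<in> vertices"
  shows "integrable M (\<lambda>\<omega>. exp (t * (U v \<omega> + a)))"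
    and "expectation (\<lambda>\<omega>. exp (t * (U v \<omega> + a))) = exp (t\<^sup>2 / 2 + t * a)"
proof -
  have eq: "exp (t * (U v \<omega> + a)) = exp (t * U v \<omega>) * exp (t * a)" for \<omega>
    by (simp add: distrib_left exp_add)
  show "integrable M (\<lambda>\<omega>. exp (t * (U v \<omega> + a)))"
    unfolding eq using gaussian_mgf(1)[OF assms, of t] by simp
  show "expectation (\<lambda>\<omega>. exp (t * (U v \<omega> + a))) = exp (t\<^sup>2 / 2 + t * a)"
    unfolding eq using gaussian_mgf[OF assms, of t] by (simp add: exp_add)
qed

text \<open>The first vertex of a branch is independent of the subtree below it.\<close>

lemma expectation_branch:
  assumes s: "s \<in> {-1, 1}" and f: "depends_measurably vertices f"
    and g: "g \<in> borel_measurable borel"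
    and int: "integrable M (\<lambda>\<omega>. f (\<lambda>v. U (s # v) \<omega>))" "integrable M (\<lambda>\<omega>. g (U [s] \<omega>))"
  shows "integrable M (\<lambda>\<omega>. g (U [s] \<omega>) * f (\<lambda>v. U (s # v) \<omega>))"
    and "expectation (\<lambda>\<omega>. g (U [s] \<omega>) * f (\<lambda>v. U (s # v) \<omega>))
      = expectation (\<lambda>\<omega>. g (U [s] \<omega>)) * expectation (\<lambda>\<omega>. f (\<lambda>v. U (s # v) \<omega>))"
proof -
  have "depends_measurably {[s]} (\<lambda>u. g (u [s]))"
    by (intro depends_measurably_compose[OF g] depends_measurably_coordinate) simp
  moreover have "depends_measurably ((#) s ` vertices) (\<lambda>u. f (\<lambda>v. u (s # v)))"
    by (rule depends_measurably_shift[OF f])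
  moreover have "[] \<notin> vertices"
    by (auto simp: vertices_def)
  ultimately have "indep_var borel (\<lambda>\<omega>. g (U [s] \<omega>)) borel (\<lambda>\<omega>. f (\<lambda>v. U (s # v) \<omega>))"
    using s Cons_in_vertices singleton_in_vertices
    by (intro indep_var_functionals) auto
  from indep_var_integrable[OF this int(2,1)] indep_var_lebesgue_integral[OF this int(2,1)]
  show "integrable M (\<lambda>\<omega>. g (U [s] \<omega>) * f (\<lambda>v. U (s # v) \<omega>))"
    and "expectation (\<lambda>\<omega>. g (U [s] \<omega>) * f (\<lambda>v. U (s # v) \<omega>))
      = expectation (\<lambda>\<omega>. g (U [s] \<omega>)) * expectation (\<lambda>\<omega>. f (\<lambda>v. U (s # v) \<omega>))"
    by auto
qed

lemma expectation_two_branches: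
  assumes f: "depends_measurably (branch (-1)) f" and g: "depends_measurably (branch 1) g"
    and int: "integrable M (\<lambda>\<omega>. f (\<lambda>v. U v \<omega>))" "integrable M (\<lambda>\<omega>. g (\<lambda>v. U v \<omega>))"
  shows "integrable M (\<lambda>\<omega>. f (\<lambda>v. U v \<omega>) * g (\<lambda>v. U v \<omega>))"
    and "expectation (\<lambda>\<omega>. f (\<lambda>v. U v \<omega>) * g (\<lambda>v. U v \<omega>))
      = expectation (\<lambda>\<omega>. f (\<lambda>v. U v \<omega>)) * expectation (\<lambda>\<omega>. g (\<lambda>v. U v \<omega>))"
proof -
  have "indep_var borel (\<lambda>\<omega>. f (\<lambda>v. U v \<omega>)) borel (\<lambda>\<omega>. g (\<lambda>v. U v \<omega>))"
    using branch_subset_vertices by (intro indep_var_functionals[OF f g] branch_disjoint) auto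
  from indep_var_integrable[OF this int] indep_var_lebesgue_integral[OF this int]
  show "integrable M (\<lambda>\<omega>. f (\<lambda>v. U v \<omega>) * g (\<lambda>v. U v \<omega>))"
    and "expectation (\<lambda>\<omega>. f (\<lambda>v. U v \<omega>) * g (\<lambda>v. U v \<omega>))
      = expectation (\<lambda>\<omega>. f (\<lambda>v. U v \<omega>)) * expectation (\<lambda>\<omega>. g (\<lambda>v. U v \<omega>))"
    by auto
qed

end

section \<open>The function psi and the critical inverse temperature\<close>

lemma psi_has_derivative: "(psi h has_real_derivative t + h * tanh (h * t)) (at t)"
  unfolding psi_def[abs_def]
  by (auto intro!: derivative_eq_intros simp: tanh_def)

lemma psi_has_derivative_field:
  "((\<lambda>h. psi h t) has_real_derivative t * tanh (h * t)) (at h)"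
  unfolding psi_def[abs_def]
  by (auto intro!: derivative_eq_intros simp: tanh_def)

lemma deriv_psi: "deriv (psi h) t = t + h * tanh (h * t)"
  by (rule DERIV_imp_deriv[OF psi_has_derivative])

lemma psi_pos: "psi h t > 0"
proof -
  have "ln (cosh (h * t)) \<ge> 0"
    using cosh_real_ge_1[of "h * t"] by simp
  moreover have "ln 2 > (0::real)"
    by simp
  ultimately show ?thesis
    by (simp add: psi_def add_nonneg_pos add_pos_nonneg)
qed

text \<open>The exponential of psi is the factor by which one generation multiplies the expected partition function; the two
  summands belong to the two children of a vertex.\<close>

lemma exp_psi: "exp (psi h b) = (\<Sum>s\<in>{-1, 1::int}. exp (b\<^sup>2 / 2 + b * (h * real_of_int s)))"
proof -
  have "exp (psi h b) = exp (b\<^sup>2 / 2) * 2 * cosh (h * b)"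
    by (simp add: psi_def exp_add)
  also have "\<dots> = (\<Sum>s\<in>{-1, 1::int}. exp (b\<^sup>2 / 2 + b * (h * real_of_int s)))"
    by (simp add: cosh_def exp_add distrib_left mult.commute)
  finally show ?thesis .
qed

text \<open>Minus the value at 0 of the tangent to psi at t. Since it increases on the positive half line, it is negative
  between 0 and \<open>\<beta>\<^sub>c\<close> and vanishes at \<open>\<beta>\<^sub>c\<close>; equivalently, \<open>psi h t / t\<close> decreases up to \<open>\<beta>\<^sub>c\<close>.\<close>

definition tangent_gap :: "real \<Rightarrow> real \<Rightarrow> real" where
  "tangent_gap h t = t * deriv (psi h) t - psi h t"

lemma tangent_gap_has_derivative:
  "(tangent_gap h has_real_derivative t + t * h\<^sup>2 * (1 - (tanh (h * t))\<^sup>2)) (at t)"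
proof -
  have "((\<lambda>t. t * (t + h * tanh (h * t)) - psi h t) has_real_derivative
      t + t * h\<^sup>2 * (1 - (tanh (h * t))\<^sup>2)) (at t)"
    by (auto intro!: derivative_eq_intros psi_has_derivative
             simp: algebra_simps power2_eq_square)
  then show ?thesis
    by (simp add: tangent_gap_def[abs_def] deriv_psi)
qed

lemma tanh_square_less_1: "(tanh (x::real))\<^sup>2 < 1"
  using tanh_real_bounds[of x] by (simp add: abs_square_less_1 abs_less_iff)

lemma tangent_gap_strict_mono:
  assumes "0 \<le> a" "a < b"
  shows "tangent_gap h a < tangent_gap h b"
proof (rule DERIV_pos_imp_increasing_open[OF assms(2)])
  fix x assume "a < x" "x < b"
  then have "x + x * h\<^sup>2 * (1 - (tanh (h * x))\<^sup>2) > 0"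
    using assms(1) tanh_square_less_1[of "h * x"] by (intro add_pos_nonneg) auto
  then show "\<exists>y. (tangent_gap h has_real_derivative y) (at x) \<and> 0 < y"
    using tangent_gap_has_derivative by blast
next
  show "continuous_on {a..b} (tangent_gap h)"
    by (rule DERIV_continuous_on, rule has_field_derivative_at_within,
        rule tangent_gap_has_derivative)
qed

text \<open>The gap grows at least as fast as \<open>t\<^sup>2 / 2\<close> and starts from \<open>- ln 2\<close>, so it is positive at
  \<open>2\<close>, since \<open>ln 2 < 2\<close>. This provides the upper end point for the intermediate value theorem.\<close>

lemma tangent_gap_2_pos: "tangent_gap h 2 > 0"
proof -
  have "tangent_gap h 0 - 0\<^sup>2 / 2 \<le> tangent_gap h 2 - 2\<^sup>2 / 2"
  proof (rule DERIV_nonneg_imp_nondecreasing[where f = "\<lambda>t. tangent_gap h t - t\<^sup>2 / 2"])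
    fix x :: real assume x: "0 \<le> x" "x \<le> 2"
    have "((\<lambda>t. tangent_gap h t - t\<^sup>2 / 2) has_real_derivative
        x * h\<^sup>2 * (1 - (tanh (h * x))\<^sup>2)) (at x)"
      by (auto intro!: derivative_eq_intros tangent_gap_has_derivative)
    moreover have "x * h\<^sup>2 * (1 - (tanh (h * x))\<^sup>2) \<ge> 0"
      using x(1) tanh_square_less_1[of "h * x"] by (intro mult_nonneg_nonneg) auto
    ultimately show "\<exists>y. ((\<lambda>t. tangent_gap h t - t\<^sup>2 / 2) has_real_derivative y) (at x) \<and> 0 \<le> y"
      by blast
  qed simp
  moreover have "tangent_gap h 0 = - ln 2"
    by (simp add: tangent_gap_def psi_def)
  moreover have "ln 2 < (2::real)"
    by (rule ln_less_self) simp
  ultimately show ?thesis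
    unfolding power2_eq_square by linarith
qed

lemma beta_c_unique: "\<exists>!b. b > 0 \<and> tangent_gap h b = 0"
proof -
  have neg: "tangent_gap h 0 < 0"
    by (simp add: tangent_gap_def psi_def)
  have "continuous_on {0..2} (tangent_gap h)"
    by (rule DERIV_continuous_on, rule has_field_derivative_at_within,
        rule tangent_gap_has_derivative)
  then obtain b where b: "0 \<le> b" "b \<le> 2" "tangent_gap h b = 0"
    using IVT'[of "tangent_gap h" 0 0 2] neg tangent_gap_2_pos[of h] by auto
  then have "b > 0"
    using neg by (cases "b = 0") auto
  moreover have "b' = b''" if "b' > 0" "b'' > 0" "tangent_gap h b' = 0" "tangent_gap h b'' = 0" for b' b''
    using that tangent_gap_strict_mono[of b' b'' h] tangent_gap_strict_mono[of b'' b' h]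
    by (cases b' b'' rule: linorder_cases) auto
  ultimately show ?thesis
    using b(3) by blast
qed

lemma beta_c_pos: "beta_c h > 0" and tangent_gap_beta_c: "tangent_gap h (beta_c h) = 0"
  using theI'[OF beta_c_unique[of h]] by (auto simp: beta_c_def tangent_gap_def)

lemma tangent_gap_neg:
  assumes "0 < b" "b < beta_c h"
  shows "tangent_gap h b < 0"
  using tangent_gap_strict_mono[of b "beta_c h" h] assms tangent_gap_beta_c[of h] by simp

text \<open>The derivative at \<open>p = 1\<close> of \<open>psi h (p * b) - p * psi h b\<close> is the tangent gap at b, which is negative
  below \<open>\<beta>\<^sub>c\<close>. The resulting inequality says that the contributions of the two branches to the p-th moment
  contract from one generation to the next.\<close>

lemma exists_moment_exponent:
  assumes "0 < b" "b < beta_c h"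
  shows "\<exists>p. 1 < p \<and> p \<le> 2 \<and> psi h (p * b) < p * psi h b"
proof -
  let ?f = "\<lambda>p. psi h (p * b) - p * psi h b"
  have "(?f has_real_derivative deriv (psi h) (1 * b) * b - psi h b) (at 1)"
    unfolding deriv_psi
    by (auto intro!: derivative_eq_intros DERIV_chain2[OF psi_has_derivative])
  moreover have "deriv (psi h) (1 * b) * b - psi h b < 0"
    using tangent_gap_neg[OF assms] by (simp add: tangent_gap_def mult.commute)
  ultimately obtain d where d: "d > 0" "\<And>e. 0 < e \<Longrightarrow> e < d \<Longrightarrow> ?f (1 + e) < ?f 1"
    using DERIV_neg_dec_right[of ?f] by blast
  define e where "e = min 1 (d / 2)"
  have "0 < e" "e < d" "e \<le> 1"
    using d(1) by (auto simp: e_def min_def)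
  then show ?thesis
    using d(2)[of e] by (intro exI[of _ "1 + e"]) auto
qed

text \<open>The field only enters psi through \<open>ln (cosh (h b))\<close>, whose derivative in \<open>h b\<close> is the mean magnetization
  \<open>tanh (h b)\<close>. So at \<open>l = 0\<close> both sides agree, and their difference has derivative \<open>- \<eta>\<close>.
  The factor e selects the direction of the deviation.\<close>

lemma exists_tilt:
  assumes "b > 0" "\<eta> > 0"
  shows "\<exists>l>0. psi (h + e * l / b) b < psi h b + l * (e * tanh (h * b) + \<eta>)"
proof -
  let ?f = "\<lambda>l. psi (h + e * l / b) b - l * (e * tanh (h * b) + \<eta>)"
  have "(?f has_real_derivative - \<eta>) (at 0)"
    using assms(1) by (auto intro!: derivative_eq_intros DERIV_chain2[OF psi_has_derivative_field])
  then obtain d where d: "d > 0" "\<And>l. 0 < l \<Longrightarrow> l < d \<Longrightarrow> ?f (0 + l) < ?f 0"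
    using DERIV_neg_dec_right[of ?f] assms(2) by fastforce
  then show ?thesis
    using d(2)[of "d / 2"] by (intro exI[of _ "d / 2"]) auto
qed

text \<open>At \<open>\<beta>\<^sub>c\<close> the tangent to psi passes through the origin, so its value at \<open>\<beta>\<close> is
  \<open>\<beta> psi(\<beta>\<^sub>c) / \<beta>\<^sub>c\<close>. By continuity the tangent at some b slightly below still exceeds T at
  \<open>\<beta>\<close>, and so does the line of a slightly smaller slope x. Such a line lies strictly above psi just to the left
  of b; the strict inequalities leave room for the error e.\<close>

lemma exists_slope_below_beta_c:
  assumes beta: "\<beta> > beta_c h" and T: "T < \<beta> * psi h (beta_c h) / beta_c h"
  shows "\<exists>b' b x e. 0 < b \<and> b < beta_c h \<and> b' < b \<and> 0 < e \<and>
    psi h b' + (b - b') * x + 3 * e \<le> psi h b \<and> T + 2 * e \<le> (\<beta> - b) * x + psi h b"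
proof -
  let ?bc = "beta_c h"
  let ?F = "\<lambda>b. psi h b + (\<beta> - b) * (b + h * tanh (h * b))"
  have bc: "?bc > 0"
    by (rule beta_c_pos)
  have slope: "?bc + h * tanh (h * ?bc) = psi h ?bc / ?bc"
    using tangent_gap_beta_c[of h] bc by (simp add: tangent_gap_def deriv_psi field_simps)
  have "?F ?bc = \<beta> * psi h ?bc / ?bc"
    unfolding slope using bc by (simp add: field_simps)
  then have F: "?F ?bc > T"
    using T by simp
  have "isCont (psi h) t" for t
    using DERIV_isCont[OF psi_has_derivative] .
  then have "isCont ?F ?bc"
    by (intro continuous_intros) auto
  then have "(?F \<longlongrightarrow> ?F ?bc) (at_left ?bc)"
    by (simp add: isCont_def filterlim_at_split)
  from order_tendstoD(1)[OF this F]
  have "\<forall>\<^sub>F b in at_left ?bc. ?F b > T" .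
  moreover have "\<forall>\<^sub>F b in at_left ?bc. 0 < b \<and> b < ?bc"
    using eventually_at_left_real[OF bc] by eventually_elim auto
  ultimately have "\<forall>\<^sub>F b in at_left ?bc. ?F b > T \<and> 0 < b \<and> b < ?bc"
    by eventually_elim auto
  then obtain b where b: "?F b > T" "0 < b" "b < ?bc"
    using eventually_happens trivial_limit_at_left_real by blast
  \<comment> \<open>Half of the surplus of the tangent at b over T is spent on lowering the slope.\<close>
  define x where "x = b + h * tanh (h * b) - (?F b - T) / (2 * (\<beta> - b))"
  have bb: "\<beta> - b > 0"
    using b beta by simp
  have x1: "x < b + h * tanh (h * b)"
    using b(1) bb by (simp add: x_def)
  have average: "T < (y + T) / 2" if "T < y" for y :: real
    using that by simp
  have cancel: "c * (y / (2 * c)) = y / 2" if "c > 0" for c y :: real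
    using that by simp
  have "(\<beta> - b) * ((?F b - T) / (2 * (\<beta> - b))) = (?F b - T) / 2"
    using cancel[OF bb] .
  then have "(\<beta> - b) * x + psi h b = (?F b + T) / 2"
    unfolding x_def right_diff_distrib[of "\<beta> - b" "b + h * tanh (h * b)"] by argo
  then have x2: "(\<beta> - b) * x + psi h b > T"
    using b(1) by (metis average)
  have "((\<lambda>t. psi h t - t * x) has_real_derivative b + h * tanh (h * b) - x) (at b)"
    by (auto intro!: derivative_eq_intros psi_has_derivative)
  from DERIV_pos_inc_left[OF this] x1
  obtain d where d: "d > 0" "\<And>r. 0 < r \<Longrightarrow> r < d \<Longrightarrow> psi h (b - r) - (b - r) * x < psi h b - b * x"
    by auto
  define b' where "b' = b - d / 2"
  have b': "b' < b" "psi h b' + (b - b') * x < psi h b"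
    using d(1) d(2)[of "d / 2"] by (auto simp: b'_def algebra_simps)
  define e where "e = min ((psi h b - (psi h b' + (b - b') * x)) / 3) (((\<beta> - b) * x + psi h b - T) / 2)"
  have "e > 0"
    using b'(2) x2 by (simp add: e_def)
  moreover have "e \<le> (psi h b - (psi h b' + (b - b') * x)) / 3"
    "e \<le> ((\<beta> - b) * x + psi h b - T) / 2"
    unfolding e_def by (rule min.cobounded1, rule min.cobounded2)
  then have "psi h b' + (b - b') * x + 3 * e \<le> psi h b"
    and "T + 2 * e \<le> (\<beta> - b) * x + psi h b"
    by simp_all
  ultimately show ?thesis
    using b(2,3) b'(1) by blast
qed

section \<open>Power inequalities\<close>

lemma powr_add_le_of_le_1:
  fixes x y q :: real
  assumes "0 \<le> x" "0 \<le> y" "0 < q" "q \<le> 1"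
  shows "(x + y) powr q \<le> x powr q + y powr q"
proof (cases "x + y = 0")
  case True
  then show ?thesis
    using assms by simp
next
  case False
  have le: "t \<le> t powr q" if "0 \<le> t" "t \<le> 1" for t :: real
    using powr_mono'[of q 1 t] that assms by simp
  let ?s = "x + y"
  have s: "?s > 0"
    using False assms by simp
  have "1 = x / ?s + y / ?s"
    using s by (simp add: add_divide_distrib[symmetric])
  also have "\<dots> \<le> (x / ?s) powr q + (y / ?s) powr q"
    using s assms by (intro add_mono le) auto
  also have "\<dots> = (x powr q + y powr q) / ?s powr q"
    using s assms by (simp add: powr_divide add_divide_distrib)
  finally show ?thesis
    using s by (simp add: le_divide_eq)
qed

text \<open>Squaring the subadditivity of the power \<open>p / 2 \<le> 1\<close>. The cross term only involves moments of order at most one of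
  either summand, so for independent summands it is controlled by the first moments.\<close>

lemma powr_add_le_cross_term:
  fixes x y p :: real
  assumes "0 \<le> x" "0 \<le> y" "0 < p" "p \<le> 2"
  shows "(x + y) powr p \<le> x powr p + y powr p + 2 * (x powr (p / 2) * y powr (p / 2))"
proof -
  have sq: "z powr p = (z powr (p / 2))\<^sup>2" for z :: real
    by (simp add: power2_eq_square flip: powr_add)
  have "((x + y) powr (p / 2))\<^sup>2 \<le> (x powr (p / 2) + y powr (p / 2))\<^sup>2"
    using assms by (intro power_mono powr_add_le_of_le_1) auto
  then show ?thesis
    unfolding sq by (simp add: power2_sum)
qed

lemma sum_powr_le_powr_sum:
  fixes f :: "'a \<Rightarrow> real"
  assumes "finite A" "\<And>a. a \<in> A \<Longrightarrow> f a > 0" "r \<ge> 1"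
  shows "(\<Sum>a\<in>A. f a powr r) \<le> (\<Sum>a\<in>A. f a) powr r"
proof -
  let ?S = "\<Sum>a\<in>A. f a"
  have S: "?S \<ge> 0"
    using assms(2) by (intro sum_nonneg less_imp_le)
  have "(\<Sum>a\<in>A. f a powr r) \<le> (\<Sum>a\<in>A. f a * ?S powr (r - 1))"
  proof (intro sum_mono)
    fix a assume a: "a \<in> A"
    have "f a powr r = f a * f a powr (r - 1)"
      using assms(2)[OF a] by (simp add: powr_mult_base)
    also have "\<dots> \<le> f a * ?S powr (r - 1)"
      using assms a by (auto intro!: mult_left_mono powr_mono2 member_le_sum intro: less_imp_le)
    finally show "f a powr r \<le> f a * ?S powr (r - 1)" .
  qed
  also have "\<dots> = ?S powr r"
    using S by (simp add: powr_mult_base flip: sum_distrib_right)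
  finally show ?thesis .
qed

section \<open>The first moment of the partition function\<close>

text \<open>The statement covers all real b and h: a negative b measures the lowest energies, and a shifted field the configurations
  of atypical magnetization.\<close>

lemma expectation_Z:
  assumes "gaussian_tree M U"
  shows "integrable M (\<lambda>\<omega>. Z (\<lambda>v. U v \<omega>) b h n)"
    and "(\<integral>\<omega>. Z (\<lambda>v. U v \<omega>) b h n \<partial>M) = exp (real n * psi h b)"
proof -
  have "integrable M (\<lambda>\<omega>. Z (\<lambda>v. U v \<omega>) b h n) \<and>
    (\<integral>\<omega>. Z (\<lambda>v. U v \<omega>) b h n \<partial>M) = exp (real n * psi h b)"
    using assms
  proof (induction n arbitrary: U)
    case 0
    then interpret gaussian_tree M U .
    show ?case by (simp add: prob_space)
  next
    case (Suc n)
    then interpret gaussian_tree M U by simp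
    have summand: "integrable M (\<lambda>\<omega>. exp (b * (U [s] \<omega> + h * real_of_int s)) * Z (\<lambda>v. U (s # v) \<omega>) b h n)"
      "(\<integral>\<omega>. exp (b * (U [s] \<omega> + h * real_of_int s)) * Z (\<lambda>v. U (s # v) \<omega>) b h n \<partial>M)
        = exp (b\<^sup>2 / 2 + b * (h * real_of_int s)) * exp (real n * psi h b)"
      if s: "s \<in> {-1, 1}" for s
    proof -
      note g = gaussian_exp_affine[OF singleton_in_vertices[OF s], of b "h * real_of_int s"]
      note IH = Suc.IH[OF subtree[OF s]]
      note * = expectation_branch[OF s depends_measurably_Z, of "\<lambda>x. exp (b * (x + h * real_of_int s))"]
      show "integrable M (\<lambda>\<omega>. exp (b * (U [s] \<omega> + h * real_of_int s)) * Z (\<lambda>v. U (s # v) \<omega>) b h n)"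
        by (rule *) (use g IH in auto)
      show "(\<integral>\<omega>. exp (b * (U [s] \<omega> + h * real_of_int s)) * Z (\<lambda>v. U (s # v) \<omega>) b h n \<partial>M)
        = exp (b\<^sup>2 / 2 + b * (h * real_of_int s)) * exp (real n * psi h b)"
        by (subst *) (use g IH in auto)
    qed
    have "(\<integral>\<omega>. Z (\<lambda>v. U v \<omega>) b h (Suc n) \<partial>M)
        = (\<Sum>s\<in>{-1, 1::int}. exp (b\<^sup>2 / 2 + b * (h * real_of_int s)) * exp (real n * psi h b))"
      unfolding Z_Suc
      by (subst Bochner_Integration.integral_sum) (use summand in \<open>auto intro!: sum.cong\<close>)
    also have "\<dots> = exp (real (Suc n) * psi h b)"
      unfolding sum_distrib_right[symmetric] exp_psi[symmetric] by (simp add: distrib_right exp_add)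
    finally show ?case
      unfolding Z_Suc using summand by (intro conjI Bochner_Integration.integrable_sum) auto
  qed
  then show "integrable M (\<lambda>\<omega>. Z (\<lambda>v. U v \<omega>) b h n)"
    and "(\<integral>\<omega>. Z (\<lambda>v. U v \<omega>) b h n \<partial>M) = exp (real n * psi h b)"
    by auto
qed

section \<open>Moments of order above one\<close>

definition normalized_Z :: "(int list \<Rightarrow> real) \<Rightarrow> real \<Rightarrow> real \<Rightarrow> nat \<Rightarrow> real" where
  "normalized_Z u b h n = Z u b h n / exp (real n * psi h b)"

definition branch_factor :: "real \<Rightarrow> real \<Rightarrow> int \<Rightarrow> real \<Rightarrow> real" where
  "branch_factor b h s x = exp (b * (x + h * real_of_int s) - psi h b)"

lemma normalized_Z_pos: "normalized_Z u b h n > 0"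
  by (simp add: normalized_Z_def Z_pos)

lemma normalized_Z_Suc:
  "normalized_Z u b h (Suc n) = (\<Sum>s\<in>{-1, 1}. branch_factor b h s (u [s]) * normalized_Z (\<lambda>v. u (s # v)) b h n)"
  unfolding normalized_Z_def Z_Suc sum_divide_distrib branch_factor_def
  by (intro sum.cong) (auto simp: exp_diff exp_add distrib_right)

lemma depends_measurably_normalized_Z: "depends_measurably vertices (\<lambda>u. normalized_Z u b h n)"
  unfolding normalized_Z_def by (rule depends_measurably_compose[OF _ depends_measurably_Z]) measurable

lemma expectation_normalized_Z:
  assumes "gaussian_tree M U"
  shows "integrable M (\<lambda>\<omega>. normalized_Z (\<lambda>v. U v \<omega>) b h n)"
    and "(\<integral>\<omega>. normalized_Z (\<lambda>v. U v \<omega>) b h n \<partial>M) = 1"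
  unfolding normalized_Z_def using expectation_Z[OF assms, of b h n] by auto

lemma (in gaussian_tree) moment_branch_factor:
  assumes s: "s \<in> {-1, 1}"
  shows "integrable M (\<lambda>\<omega>. branch_factor b h s (U [s] \<omega>) powr p)"
    and "expectation (\<lambda>\<omega>. branch_factor b h s (U [s] \<omega>) powr p)
      = exp ((p * b)\<^sup>2 / 2 + p * b * (h * real_of_int s)) / exp (p * psi h b)"
proof -
  have eq: "branch_factor b h s x powr p
      = exp (p * b * (x + h * real_of_int s)) / exp (p * psi h b)" for x
    by (simp add: branch_factor_def powr_def algebra_simps flip: exp_diff)
  note g = gaussian_exp_affine[OF singleton_in_vertices[OF s], of "p * b" "h * real_of_int s"]
  show "integrable M (\<lambda>\<omega>. branch_factor b h s (U [s] \<omega>) powr p)"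
    "expectation (\<lambda>\<omega>. branch_factor b h s (U [s] \<omega>) powr p)
      = exp ((p * b)\<^sup>2 / 2 + p * b * (h * real_of_int s)) / exp (p * psi h b)"
    unfolding eq using g by auto
qed

text \<open>By the recursion the normalized partition function is a sum of two independent terms, one for each branch. Expanding
  the p-th power with the cross term inequality, the pure powers give the factor
  \<open>\<rho> = exp (psi h (p * b) - p * psi h b) < 1\<close> times the p-th moment in the previous generation, and the cross term
  is bounded by 8. Hence the fixed point K of \<open>K = \<rho> * K + 8\<close> bounds all these moments.\<close>

lemma normalized_Z_moment_bounded:
  assumes p: "1 < p" "p \<le> 2" and contract: "psi h (p * b) < p * psi h b"
  defines "K \<equiv> 8 / (1 - exp (psi h (p * b) - p * psi h b))"
  assumes "gaussian_tree M U"
  shows "integrable M (\<lambda>\<omega>. normalized_Z (\<lambda>v. U v \<omega>) b h n powr p)"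
    and "(\<integral>\<omega>. normalized_Z (\<lambda>v. U v \<omega>) b h n powr p \<partial>M) \<le> K"
proof -
  define \<rho> where "\<rho> = exp (psi h (p * b) - p * psi h b)"
  have \<rho>: "0 < \<rho>" "\<rho> < 1"
    using contract by (auto simp: \<rho>_def)
  have K_eq: "K = 8 / (1 - \<rho>)"
    by (simp add: K_def \<rho>_def)
  have K_fixpoint: "K = \<rho> * K + 8"
    using K_eq \<rho> by (simp add: field_simps)
  have K_ge_1: "K \<ge> 1"
    unfolding K_eq using \<rho> by (simp add: le_divide_eq)
  have "integrable M (\<lambda>\<omega>. normalized_Z (\<lambda>v. U v \<omega>) b h n powr p) \<and>
    (\<integral>\<omega>. normalized_Z (\<lambda>v. U v \<omega>) b h n powr p \<partial>M) \<le> K"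
    using assms(5)
  proof (induction n arbitrary: U)
    case 0
    then interpret gaussian_tree M U .
    show ?case using K_ge_1 by (simp add: normalized_Z_def prob_space)
  next
    case (Suc n)
    then interpret gaussian_tree M U by simp
    define x where "x s u = branch_factor b h s (u [s]) * normalized_Z (\<lambda>v. u (s # v)) b h n" for s u
    define Y where "Y s \<omega> = x s (\<lambda>v. U v \<omega>)" for s \<omega>
    have x_nonneg: "x s u \<ge> 0" for s u
      by (simp add: x_def branch_factor_def less_imp_le[OF normalized_Z_pos])
    then have Y_nonneg: "Y s \<omega> \<ge> 0" for s \<omega>
      by (simp add: Y_def)
    have dep: "depends_measurably (branch s) (x s)" for s
      unfolding x_def branch_factor_def
      by (rule depends_measurably_mult[OF
            depends_measurably_compose[OF _ depends_measurably_root]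
            depends_measurably_subtree[OF depends_measurably_normalized_Z]]) measurable
    have Y_meas: "Y s \<in> borel_measurable M" if "s \<in> {-1, 1}" for s
      unfolding Y_def[abs_def]
      by (rule random_variable_functional[OF dep branch_subset_vertices[OF that]])
    have Y_mean: "integrable M (Y s)" "expectation (Y s) \<le> 1" if s: "s \<in> {-1, 1}" for s
    proof -
      note m = moment_branch_factor[OF s, of b h 1]
      note w = expectation_normalized_Z[OF subtree[OF s], of b h n]
      have one: "branch_factor b h s y powr 1 = branch_factor b h s y" for y
        by (simp add: branch_factor_def)
      have *: "branch_factor b h s \<in> borel_measurable borel"
        unfolding branch_factor_def by measurable
      note e = expectation_branch[OF s depends_measurably_normalized_Z *, OF w(1) m(1)[unfolded one]]
      show "integrable M (Y s)"
        unfolding Y_def x_def by (rule e)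
      have "exp (b\<^sup>2 / 2 + b * (h * real_of_int s)) \<le> exp (psi h b)"
        unfolding exp_psi by (rule member_le_sum[OF s]) auto
      then show "expectation (Y s) \<le> 1"
        unfolding Y_def x_def e(2) w(2) m(2)[unfolded one] by simp
    qed
    have Y_p: "integrable M (\<lambda>\<omega>. Y s \<omega> powr p)"
      "expectation (\<lambda>\<omega>. Y s \<omega> powr p)
        \<le> exp ((p * b)\<^sup>2 / 2 + p * b * (h * real_of_int s)) / exp (p * psi h b) * K"
      if s: "s \<in> {-1, 1}" for s
    proof -
      note m = moment_branch_factor[OF s, of b h p]
      note IH = Suc.IH[OF subtree[OF s]]
      have *: "(\<lambda>y. branch_factor b h s y powr p) \<in> borel_measurable borel"
        unfolding branch_factor_def by measurable
      have **: "depends_measurably vertices (\<lambda>u. normalized_Z u b h n powr p)"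
        by (rule depends_measurably_compose[OF _ depends_measurably_normalized_Z]) measurable
      have eq: "Y s \<omega> powr p = branch_factor b h s (U [s] \<omega>) powr p * normalized_Z (\<lambda>v. U (s # v) \<omega>) b h n powr p" for \<omega>
        unfolding Y_def x_def by (intro powr_mult)
      note e = expectation_branch[OF s ** *, OF conjunct1[OF IH] m(1)]
      show "integrable M (\<lambda>\<omega>. Y s \<omega> powr p)"
        unfolding eq by (rule e)
      show "expectation (\<lambda>\<omega>. Y s \<omega> powr p)
        \<le> exp ((p * b)\<^sup>2 / 2 + p * b * (h * real_of_int s)) / exp (p * psi h b) * K"
        unfolding eq e(2) m(2) using IH by (intro mult_left_mono) auto
    qed
    \<comment> \<open>Since p / 2 is at most 1, the power is dominated by 1 plus its base, which has mean at most 1.\<close>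
    have Y_half: "integrable M (\<lambda>\<omega>. Y s \<omega> powr (p / 2))"
      "expectation (\<lambda>\<omega>. Y s \<omega> powr (p / 2)) \<le> 2" if s: "s \<in> {-1, 1}" for s
    proof -
      have le: "Y s \<omega> powr (p / 2) \<le> 1 + Y s \<omega>" for \<omega>
      proof (cases "Y s \<omega> \<le> 1")
        case True
        then have "Y s \<omega> powr (p / 2) \<le> 1"
          using p Y_nonneg by (intro powr_le1) auto
        then show ?thesis using Y_nonneg[of s \<omega>] by simp
      next
        case False
        then have "Y s \<omega> powr (p / 2) \<le> Y s \<omega> powr 1"
          using p by (intro powr_mono) auto
        then show ?thesis using False by simp
      qed
      have int: "integrable M (\<lambda>\<omega>. 1 + Y s \<omega>)"
        using Y_mean[OF s] by simp
      show i: "integrable M (\<lambda>\<omega>. Y s \<omega> powr (p / 2))"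
        by (rule Bochner_Integration.integrable_bound[OF int])
           (use Y_meas[OF s] le Y_nonneg in \<open>auto intro!: AE_I2\<close>)
      have "expectation (\<lambda>\<omega>. Y s \<omega> powr (p / 2)) \<le> expectation (\<lambda>\<omega>. 1 + Y s \<omega>)"
        by (rule integral_mono[OF i int le])
      also have "\<dots> \<le> 2"
        using Y_mean[OF s] by (simp add: prob_space)
      finally show "expectation (\<lambda>\<omega>. Y s \<omega> powr (p / 2)) \<le> 2" .
    qed
    have dep_half: "depends_measurably (branch s) (\<lambda>u. x s u powr (p / 2))" for s
      by (rule depends_measurably_compose[OF _ dep]) measurable
    note cross = expectation_two_branches[OF dep_half dep_half, folded Y_def, OF Y_half(1) Y_half(1)]
    have cross_le: "expectation (\<lambda>\<omega>. Y (-1) \<omega> powr (p / 2) * Y 1 \<omega> powr (p / 2)) \<le> 2 * 2"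
    proof -
      have "expectation (\<lambda>\<omega>. Y (-1) \<omega> powr (p / 2) * Y 1 \<omega> powr (p / 2))
          = expectation (\<lambda>\<omega>. Y (-1) \<omega> powr (p / 2)) * expectation (\<lambda>\<omega>. Y 1 \<omega> powr (p / 2))"
        by (rule cross(2)) auto
      also have "\<dots> \<le> 2 * 2"
        by (intro mult_mono Y_half(2)) (auto intro!: integral_nonneg_AE)
      finally show ?thesis .
    qed
    let ?R = "\<lambda>\<omega>. Y (-1) \<omega> powr p + Y 1 \<omega> powr p + 2 * (Y (-1) \<omega> powr (p / 2) * Y 1 \<omega> powr (p / 2))"
    have normalized_Z_eq: "normalized_Z (\<lambda>v. U v \<omega>) b h (Suc n) = Y (-1) \<omega> + Y 1 \<omega>" for \<omega>
      by (simp add: normalized_Z_Suc Y_def x_def)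
    have le: "normalized_Z (\<lambda>v. U v \<omega>) b h (Suc n) powr p \<le> ?R \<omega>" for \<omega>
      unfolding normalized_Z_eq using p Y_nonneg by (intro powr_add_le_cross_term) auto
    have R: "integrable M ?R"
      using Y_p(1) cross(1) by auto
    have i: "integrable M (\<lambda>\<omega>. normalized_Z (\<lambda>v. U v \<omega>) b h (Suc n) powr p)"
      by (rule Bochner_Integration.integrable_bound[OF R])
         (use le Y_meas[of 1] Y_meas[of "-1"] in \<open>auto intro!: AE_I2 simp: normalized_Z_eq\<close>)
    have "expectation (\<lambda>\<omega>. normalized_Z (\<lambda>v. U v \<omega>) b h (Suc n) powr p) \<le> expectation ?R"
      by (rule integral_mono[OF i R le])
    also have "\<dots> = expectation (\<lambda>\<omega>. Y (-1) \<omega> powr p) + expectation (\<lambda>\<omega>. Y 1 \<omega> powr p)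
        + 2 * expectation (\<lambda>\<omega>. Y (-1) \<omega> powr (p / 2) * Y 1 \<omega> powr (p / 2))"
      using Y_p(1) cross(1) by simp
    also have "\<dots> \<le> (\<Sum>s\<in>{-1, 1::int}. exp ((p * b)\<^sup>2 / 2 + p * b * (h * real_of_int s)) / exp (p * psi h b) * K) + 2 * (2 * 2)"
      using Y_p(2)[of 1] Y_p(2)[of "-1"] cross_le by simp
    also have "(\<Sum>s\<in>{-1, 1::int}. exp ((p * b)\<^sup>2 / 2 + p * b * (h * real_of_int s)) / exp (p * psi h b) * K) = \<rho> * K"
      unfolding sum_distrib_right[symmetric] sum_divide_distrib[symmetric] exp_psi[symmetric] \<rho>_def exp_diff ..
    finally show ?case
      using i K_fixpoint by simp
  qed
  then show "integrable M (\<lambda>\<omega>. normalized_Z (\<lambda>v. U v \<omega>) b h n powr p)"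
    and "(\<integral>\<omega>. normalized_Z (\<lambda>v. U v \<omega>) b h n powr p \<partial>M) \<le> K"
    by auto
qed

section \<open>Lower deviations of the partition function below the critical inverse temperature\<close>

text \<open>A variant of the Paley-Zygmund inequality. The normalized partition function has mean 1; values below 1/2 contribute at
  most 1/2 to it, and by the moment bound values above a large constant L contribute at most 1/4. So values
  between 1/2 and L carry mass at least \<open>1 / (4 * L)\<close>.\<close>

lemma normalized_Z_ge_half_uniformly:
  assumes "0 < b" "b < beta_c h"
  shows "\<exists>p0>0. p0 \<le> 1 \<and> (\<forall>(M :: 'w measure) U n. gaussian_tree M U \<longrightarrow>
    (\<integral>\<omega>. indicator {..<1/2} (normalized_Z (\<lambda>v. U v \<omega>) b h n) \<partial>M) \<le> (1 - p0 :: real))"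
proof -
  obtain p where p: "1 < p" "p \<le> 2" and contract: "psi h (p * b) < p * psi h b"
    using exists_moment_exponent[OF assms] by blast
  define K where "K = 8 / (1 - exp (psi h (p * b) - p * psi h b))"
  \<comment> \<open>Chosen so that K * L powr (1 - p) = 1 / 4.\<close>
  define L where "L = (4 * K) powr (1 / (p - 1))"
  have K: "K \<ge> 1"
    using contract exp_gt_zero[of "psi h (p * b) - p * psi h b"]
    unfolding K_def by (simp add: le_divide_eq del: exp_gt_zero)
  have L: "L \<ge> 1"
    unfolding L_def using K p by (intro ge_one_powr_ge_zero) auto
  have "L powr (1 - p) = (4 * K) powr (- 1)"
    unfolding L_def powr_powr using p by (intro arg_cong2[where f = "(powr)"]) (auto simp: field_simps)
  then have KL: "K * L powr (1 - p) = 1 / 4"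
    using K by (simp add: powr_minus field_simps)
  have bound: "(\<integral>\<omega>. indicator {..<1/2} (normalized_Z (\<lambda>v. U v \<omega>) b h n) \<partial>M) \<le> 1 - 1 / (4 * L)"
    if "gaussian_tree M U" for M :: "'w measure" and U n
  proof -
    interpret gaussian_tree M U by fact
    define w where "w \<omega> = normalized_Z (\<lambda>v. U v \<omega>) b h n" for \<omega>
    define I where "I \<omega> = (indicator {..<1/2} (w \<omega>) :: real)" for \<omega>
    note mean = expectation_normalized_Z[OF that, of b h n, folded w_def]
    note mom = normalized_Z_moment_bounded[OF p contract that, where n = n, folded w_def K_def]
    have [measurable]: "w \<in> borel_measurable M"
      using mean(1) by auto
    have w_pos: "w \<omega> > 0" for \<omega>
      by (simp add: w_def normalized_Z_pos)
    have int_I: "integrable M I"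
      unfolding I_def[abs_def] by (rule integrable_const_bound[of _ 1]) auto
    have le: "w \<omega> \<le> 1 / 2 + L * (1 - I \<omega>) + L powr (1 - p) * w \<omega> powr p" for \<omega>
    proof -
      have nonneg: "L powr (1 - p) * w \<omega> powr p \<ge> 0"
        by simp
      consider "w \<omega> < 1/2" | "1/2 \<le> w \<omega>" "w \<omega> \<le> L" | "1/2 \<le> w \<omega>" "L < w \<omega>"
        by linarith
      then show ?thesis
      proof cases
        case 1
        then have "L * (1 - I \<omega>) = 0"
          by (simp add: I_def)
        then show ?thesis
          using 1 nonneg by linarith
      next
        case 2
        then have "L * (1 - I \<omega>) = L"
          by (simp add: I_def)
        then show ?thesis
          using 2 nonneg by linarith
      next
        case 3
        have "w \<omega> = w \<omega> powr (1 - p) * w \<omega> powr p"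
          using w_pos[of \<omega>] by (simp flip: powr_add)
        also have "\<dots> \<le> L powr (1 - p) * w \<omega> powr p"
          using 3 L p by (intro mult_right_mono powr_mono2') auto
        finally show ?thesis
          using 3 L by (simp add: I_def)
      qed
    qed
    have "1 = expectation w"
      using mean(2) by simp
    also have "\<dots> \<le> expectation (\<lambda>\<omega>. 1 / 2 + L * (1 - I \<omega>) + L powr (1 - p) * w \<omega> powr p)"
      using mean(1) mom(1) int_I by (intro integral_mono le) auto
    also have "\<dots> = 1 / 2 + L * (1 - expectation I) + L powr (1 - p) * expectation (\<lambda>\<omega>. w \<omega> powr p)"
      using mom(1) int_I by (simp add: prob_space)
    also have "\<dots> \<le> 1 / 2 + L * (1 - expectation I) + L powr (1 - p) * K"
      using mom(2) by (intro add_left_mono mult_left_mono) auto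
    finally have "1 / 4 \<le> L * (1 - expectation I)"
      using KL by (simp add: mult.commute)
    then have "expectation I \<le> 1 - 1 / (4 * L)"
      using L by (simp add: field_simps)
    then show ?thesis
      by (simp add: I_def[abs_def] w_def[abs_def])
  qed
  have "0 < 1 / (4 * L)" "1 / (4 * L) \<le> 1"
    using L by auto
  then show ?thesis
    using bound by blast
qed

text \<open>The subtrees below level k are independent. For an indicator function f, this bounds the probability that an event of
  probability at most q occurs in every one of them.\<close>

lemma expectation_all_subtrees:
  fixes f :: "(int list \<Rightarrow> real) \<Rightarrow> real"
  assumes dep: "depends_measurably vertices f"
    and range: "\<And>u. 0 \<le> f u" "\<And>u. f u \<le> 1"
    and q: "\<And>U. gaussian_tree M U \<Longrightarrow> (\<integral>\<omega>. f (\<lambda>v. U v \<omega>) \<partial>M) \<le> q"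
    and tree: "gaussian_tree M U"
  defines "P \<equiv> \<lambda>k u. \<Prod>v\<in>configs k. f (\<lambda>w. u (v @ w))"
  shows "integrable M (\<lambda>\<omega>. P k (\<lambda>v. U v \<omega>))"
    and "(\<integral>\<omega>. P k (\<lambda>v. U v \<omega>) \<partial>M) \<le> q ^ (2 ^ k)"
proof -
  have P_Suc: "P (Suc k) u = P k (\<lambda>v. u (-1 # v)) * P k (\<lambda>v. u (1 # v))" for k u
    by (simp add: P_def prod_configs_Suc)
  have P_dep: "depends_measurably vertices (P k)" for k
  proof (induction k)
    case 0
    then show ?case using dep by (simp add: P_def)
  next
    case (Suc k)
    have "depends_measurably vertices (\<lambda>u. P k (\<lambda>v. u (s # v)))" if "s \<in> {-1, 1}" for s
      by (rule depends_measurably_branch[OF that depends_measurably_subtree[OF Suc]])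
    from depends_measurably_mult[OF this[of "-1"] this[of 1]] show ?case
      by (simp add: P_Suc[abs_def])
  qed
  have P_range: "0 \<le> P k u" "P k u \<le> 1" for k u
    unfolding P_def using range by (auto intro: prod_nonneg prod_le_1)
  have P_int: "integrable M (\<lambda>\<omega>. P k (\<lambda>v. U v \<omega>))" if "gaussian_tree M U" for U k
  proof -
    interpret gaussian_tree M U by fact
    show ?thesis
      by (rule integrable_const_bound[of _ 1])
         (use P_range in \<open>auto intro!: random_variable_functional[OF P_dep]\<close>)
  qed
  show "integrable M (\<lambda>\<omega>. P k (\<lambda>v. U v \<omega>))"
    by (rule P_int[OF tree])
  show "(\<integral>\<omega>. P k (\<lambda>v. U v \<omega>) \<partial>M) \<le> q ^ (2 ^ k)"
    using tree
  proof (induction k arbitrary: U)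
    case 0
    then show ?case using q by (simp add: P_def)
  next
    case (Suc k)
    then interpret gaussian_tree M U by simp
    have sub: "gaussian_tree M (\<lambda>v. U (s # v))" if "s \<in> {-1, 1}" for s
      by (rule subtree[OF that])
    have "expectation (\<lambda>\<omega>. P (Suc k) (\<lambda>v. U v \<omega>))
        = expectation (\<lambda>\<omega>. P k (\<lambda>v. U (-1 # v) \<omega>)) * expectation (\<lambda>\<omega>. P k (\<lambda>v. U (1 # v) \<omega>))"
      unfolding P_Suc
      using P_int[OF sub[of "-1"]] P_int[OF sub[of 1]]
      by (intro expectation_two_branches depends_measurably_subtree P_dep) auto
    also have "\<dots> \<le> q ^ (2 ^ k) * q ^ (2 ^ k)"
    proof (rule mult_mono')
      show "expectation (\<lambda>\<omega>. P k (\<lambda>v. U (-1 # v) \<omega>)) \<le> q ^ (2 ^ k)"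
        "expectation (\<lambda>\<omega>. P k (\<lambda>v. U (1 # v) \<omega>)) \<le> q ^ (2 ^ k)"
        using Suc.IH[OF sub[of "-1"]] Suc.IH[OF sub[of 1]] by auto
    qed (auto intro!: integral_nonneg_AE P_range)
    also have "\<dots> = q ^ (2 ^ Suc k)"
      by (simp add: mult_2 power_add)
    finally show ?case .
  qed
qed

text \<open>Z is at least the weight of a path of length k times the partition function of the subtree below it. Two events
  can spoil this. Either some path has energy below \<open>- D * k\<close>, which Markov's inequality for Z at inverse temperature
  \<open>- 1\<close> excludes up to a probability of \<open>exp (- k)\<close>. Or all \<open>2 ^ k\<close> subtrees are atypically small,
  which has probability at most \<open>(1 - p0) ^ 2 ^ k\<close>. With \<open>k \<approx> \<kappa> * n\<close> both probabilities decay
  exponentially in n, and if \<open>\<kappa>\<close> is small then the loss along the path stays below \<open>exp (- n * e)\<close>.\<close>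

lemma Z_lower_deviation:
  assumes b: "0 < b" "b < beta_c h" and e: "e > 0"
  shows "\<exists>c>0. \<exists>C. \<forall>(M :: 'w measure) U n. gaussian_tree M U \<longrightarrow>
    (\<integral>\<omega>. indicator {..<exp (real n * (psi h b - e))} (Z (\<lambda>v. U v \<omega>) b h n) \<partial>M)
      \<le> (C * exp (- c * real n) :: real)"
proof -
  obtain p0 where p0: "0 < p0" "p0 \<le> 1"
    and half: "\<And>(M :: 'w measure) U n. gaussian_tree M U \<Longrightarrow>
      (\<integral>\<omega>. indicator {..<1/2} (normalized_Z (\<lambda>v. U v \<omega>) b h n) \<partial>M) \<le> (1 - p0 :: real)"
    using normalized_Z_ge_half_uniformly[OF b, where 'w = 'w] by blast
  \<comment> \<open>E is the loss in the exponent for each of the k levels of the path, where D bounds the energy per level.\<close>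
  define D where "D = psi h (-1) + 1"
  define E where "E = b * D + psi h b"
  have D: "D > 0" and E: "E > 0"
    using psi_pos[of h "-1"] psi_pos[of h b] b(1) by (auto simp: D_def E_def add_pos_pos)
  define \<kappa> where "\<kappa> = min 1 (e / (2 * E))"
  have \<kappa>: "0 < \<kappa>" "\<kappa> \<le> 1" "\<kappa> * E \<le> e / 2"
    using e E by (auto simp: \<kappa>_def min_def field_simps)
  define c where "c = p0 * \<kappa>"
  \<comment> \<open>From N on, the factor 1/2 costs at most half of the allowed error; smaller n are absorbed by C.\<close>
  define N where "N = 2 * ln 2 / e"
  define C where "C = exp (c * N) + 2 * exp p0"
  have c: "c > 0"
    using p0 \<kappa> by (simp add: c_def)
  have "(\<integral>\<omega>. indicator {..<exp (real n * (psi h b - e))} (Z (\<lambda>v. U v \<omega>) b h n) \<partial>M)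
      \<le> C * exp (- c * real n)" if tree: "gaussian_tree M U" for M :: "'w measure" and U n
  proof -
    interpret gaussian_tree M U by fact
    define J where "J \<omega> = (indicator {..<exp (real n * (psi h b - e))} (Z (\<lambda>v. U v \<omega>) b h n) :: real)" for \<omega>
    have J_int: "integrable M J"
      unfolding J_def[abs_def] by (rule integrable_const_bound[of _ 1]) auto
    have J_le_1: "J \<omega> \<le> 1" for \<omega>
      by (simp add: J_def indicator_def)
    have "expectation J \<le> C * exp (- c * real n)"
    proof (cases "real n < N")
      case True
      have "expectation J \<le> expectation (\<lambda>\<omega>. 1)"
        by (intro integral_mono J_int J_le_1) auto
      also have "\<dots> \<le> exp (c * N) * exp (- c * real n)"
        using True c by (simp add: prob_space flip: exp_add)
      also have "\<dots> \<le> C * exp (- c * real n)"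
        by (simp add: C_def)
      finally show ?thesis .
    next
      case False
      define k where "k = nat \<lfloor>\<kappa> * real n\<rfloor>"
      have \<kappa>n: "\<kappa> * real n \<ge> 0" "\<kappa> * real n \<le> real n"
        using \<kappa> by (auto simp: mult_left_le_one_le)
      have k: "real k \<le> \<kappa> * real n" "\<kappa> * real n - 1 \<le> real k"
        unfolding k_def using \<kappa>n(1) by linarith+
      have "k \<le> n"
        using k(1) \<kappa>n(2) by linarith
      define m where "m = n - k"
      have n: "n = k + m"
        using \<open>k \<le> n\<close> by (simp add: m_def)
      have budget: "real k * E + ln 2 \<le> real n * e"
      proof -
        have "real k * E \<le> (\<kappa> * real n) * E"
          using k(1) E by (intro mult_right_mono) auto
        also have "\<dots> = real n * (\<kappa> * E)"
          by simp
        also have "\<dots> \<le> real n * (e / 2)"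
          using \<kappa>(3) by (intro mult_left_mono) auto
        finally have "real k * E \<le> real n * (e / 2)" .
        moreover have "ln 2 \<le> real n * (e / 2)"
          using False e by (simp add: N_def field_simps)
        ultimately show ?thesis
          by simp
      qed
      define f where "f u = (indicator {..<1/2} (normalized_Z u b h m) :: real)" for u
      define P where "P u = (\<Prod>v\<in>configs k. f (\<lambda>w. u (v @ w)))" for u
      have f_dep: "depends_measurably vertices f"
        unfolding f_def[abs_def]
        by (rule depends_measurably_compose[OF _ depends_measurably_normalized_Z]) measurable
      note all_fail = expectation_all_subtrees[OF f_dep _ _ _ tree, of "1 - p0" k]
      have P: "integrable M (\<lambda>\<omega>. P (\<lambda>v. U v \<omega>))"
        "expectation (\<lambda>\<omega>. P (\<lambda>v. U v \<omega>)) \<le> (1 - p0) ^ (2 ^ k)"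
        unfolding P_def by (rule all_fail; use half in \<open>auto simp: f_def\<close>)+
      note Zk = expectation_Z[OF tree, of "-1" h k]
      have P_nonneg: "P u \<ge> 0" for u
        by (auto simp: P_def f_def intro: prod_nonneg)
      have le: "J \<omega> \<le> P (\<lambda>v. U v \<omega>) + Z (\<lambda>v. U v \<omega>) (-1) h k * exp (- (D * real k))" for \<omega>
      proof -
        define u where "u = (\<lambda>v. U v \<omega>)"
        have Zpos: "Z u (-1) h k * exp (- (D * real k)) \<ge> 0"
          by (simp add: less_imp_le[OF Z_pos])
        consider (deep) "Z u (-1) h k \<ge> exp (D * real k)"
          | (fail) "\<And>v. v \<in> configs k \<Longrightarrow> normalized_Z (\<lambda>w. u (v @ w)) b h m < 1/2"
          | (good) v where "Z u (-1) h k < exp (D * real k)" "v \<in> configs k" "normalized_Z (\<lambda>w. u (v @ w)) b h m \<ge> 1/2"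
          by force
        then have "J \<omega> \<le> P u + Z u (-1) h k * exp (- (D * real k))"
        proof cases
          case deep
          then have "1 \<le> Z u (-1) h k * exp (- (D * real k))"
            by (simp add: exp_minus field_simps)
          then show ?thesis
            using J_le_1[of \<omega>] P_nonneg[of u] by linarith
        next
          case fail
          then have "P u = 1"
            by (simp add: P_def f_def)
          then show ?thesis
            using J_le_1[of \<omega>] Zpos by linarith
        next
          case good
          have "exp (- 1 * H u h k v) \<le> Z u (-1) h k"
            unfolding Z_def using good(2) by (intro member_le_sum) auto
          from this good(1) have "exp (- 1 * H u h k v) < exp (D * real k)"
            by (rule order.strict_trans1)
          then have Hv: "H u h k v > - (D * real k)"
            unfolding exp_less_cancel_iff by linarith
          have "real n * (psi h b - e) \<le> b * (- (D * real k)) + (real m * psi h b - ln 2)"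
            using budget by (simp add: n E_def algebra_simps)
          then have "exp (real n * (psi h b - e))
              \<le> exp (b * (- (D * real k)) + (real m * psi h b - ln 2))"
            by (simp only: exp_le_cancel_iff)
          also have "\<dots> = exp (b * (- (D * real k))) * (exp (real m * psi h b) / 2)"
            by (simp only: exp_add exp_diff) simp
          also have "\<dots> \<le> exp (b * H u h k v) * Z (\<lambda>w. u (v @ w)) b h m"
            using mult_left_mono[OF less_imp_le[OF Hv] less_imp_le[OF b(1)]] good(3)
            by (intro mult_mono) (auto simp: normalized_Z_def le_divide_eq)
          also have "\<dots> \<le> Z u b h n"
            unfolding n by (rule Z_ge_subtree[OF good(2)])
          finally have "J \<omega> = 0"
            by (simp add: J_def u_def)
          then show ?thesis
            using P_nonneg[of u] Zpos by linarith
        qed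
        then show ?thesis
          by (simp add: u_def)
      qed
      have "expectation J \<le> expectation (\<lambda>\<omega>. P (\<lambda>v. U v \<omega>) + Z (\<lambda>v. U v \<omega>) (-1) h k * exp (- (D * real k)))"
        using P(1) Zk(1) by (intro integral_mono J_int le) auto
      also have "\<dots> = expectation (\<lambda>\<omega>. P (\<lambda>v. U v \<omega>)) + exp (real k * psi h (-1)) * exp (- (D * real k))"
        using P(1) Zk by simp
      also have "\<dots> \<le> (1 - p0) ^ (2 ^ k) + exp (- real k)"
        using P(2) by (simp add: D_def algebra_simps flip: exp_add)
      also have "(1 - p0) ^ (2 ^ k) \<le> exp (- p0 * real k)"
      proof -
        have "(1 - p0) ^ (2 ^ k) \<le> (1 - p0) ^ k"
          using p0 by (intro power_decreasing) (auto intro: less_imp_le)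
        also have "\<dots> \<le> exp (- p0) ^ k"
          using p0 exp_ge_add_one_self[of "- p0"] by (intro power_mono) auto
        also have "\<dots> = exp (- p0 * real k)"
          by (simp add: mult.commute flip: exp_of_nat_mult)
        finally show ?thesis .
      qed
      also have "exp (- real k) \<le> exp (- p0 * real k)"
        using p0 by (simp add: mult_left_le_one_le)
      also have "exp (- p0 * real k) + exp (- p0 * real k) \<le> 2 * (exp p0 * exp (- c * real n))"
        using mult_left_mono[OF k(2), of p0] p0 by (simp add: c_def algebra_simps flip: exp_add)
      also have "\<dots> \<le> C * exp (- c * real n)"
        by (simp add: C_def distrib_right)
      finally show ?thesis by simp
    qed
    then show ?thesis
      by (simp add: J_def[abs_def])
  qed
  then show ?thesis
    using c by blast
qed

section \<open>The partition function beyond the critical inverse temperature\<close>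

text \<open>A form of the convexity of \<open>ln Z\<close> in the inverse temperature. Each weight \<open>exp (b * t)\<close> is compared with
  inverse temperature \<open>b'\<close> if the energy t is below y, and with \<open>\<beta>\<close> if it is above.\<close>

lemma Z_ge_tangent_difference:
  assumes "b' \<le> b" "b \<le> \<beta>"
  shows "exp ((\<beta> - b) * y) * (Z u b h n - exp ((b - b') * y) * Z u b' h n) \<le> Z u \<beta> h n"
proof -
  have le: "exp (b * t) \<le> exp ((b - b') * y) * exp (b' * t) + exp (- ((\<beta> - b) * y)) * exp (\<beta> * t)" for t
  proof (cases "t \<le> y")
    case True
    have "(b - b') * t \<le> (b - b') * y"
      using assms True by (intro mult_left_mono) auto
    then have "b * t \<le> (b - b') * y + b' * t"
      by (simp add: left_diff_distrib)
    then have "exp (b * t) \<le> exp ((b - b') * y) * exp (b' * t)"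
      by (simp flip: exp_add)
    then show ?thesis
      by (rule order_trans) simp
  next
    case False
    have "(\<beta> - b) * y \<le> (\<beta> - b) * t"
      using assms False by (intro mult_left_mono) auto
    then have "b * t \<le> - ((\<beta> - b) * y) + \<beta> * t"
      by (simp add: left_diff_distrib)
    then have "exp (b * t) \<le> exp (- ((\<beta> - b) * y)) * exp (\<beta> * t)"
      by (simp flip: exp_add)
    then show ?thesis
      by (rule order_trans) simp
  qed
  have "Z u b h n \<le> exp ((b - b') * y) * Z u b' h n + exp (- ((\<beta> - b) * y)) * Z u \<beta> h n"
    unfolding Z_def sum_distrib_left sum.distrib[symmetric] by (intro sum_mono le)
  then have "Z u b h n - exp ((b - b') * y) * Z u b' h n \<le> exp (- ((\<beta> - b) * y)) * Z u \<beta> h n"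
    by simp
  then have "exp ((\<beta> - b) * y) * (Z u b h n - exp ((b - b') * y) * Z u b' h n)
      \<le> exp ((\<beta> - b) * y) * (exp (- ((\<beta> - b) * y)) * Z u \<beta> h n)"
    by (intro mult_left_mono) auto
  also have "\<dots> = Z u \<beta> h n"
    by (simp add: exp_minus)
  finally show ?thesis .
qed

text \<open>If Z at \<open>b'\<close> stays below the line of slope x through the bound at b, then the energies below
  \<open>n * x\<close> are negligible for Z at b, and the remaining ones gain at least \<open>exp (n * (\<beta> - b) * x)\<close>
  when b is raised to \<open>\<beta>\<close>.\<close>

lemma Z_ge_of_tangent_slope:
  assumes "b' < b" "b < \<beta>" "r > 0" "n \<ge> 1"
    and lower: "exp (real n * (A - r)) \<le> Z u b h n"
    and upper: "Z u b' h n \<le> exp (real n * (A' + r))"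
    and slope: "A' + (b - b') * x + 3 * r \<le> A" "T + 2 * r \<le> (\<beta> - b) * x + A"
  shows "(1 - exp (- r)) * exp (real n * (T + r)) \<le> Z u \<beta> h n"
proof -
  let ?n = "real n"
  have "?n * ((b - b') * x + (A' + r)) \<le> ?n * (A - r - r)"
    using slope(1) by (intro mult_left_mono) auto
  then have "exp ((b - b') * (?n * x)) * exp (?n * (A' + r)) \<le> exp (?n * (A - r)) * exp (- (?n * r))"
    by (simp add: algebra_simps flip: exp_add)
  also have "\<dots> \<le> exp (?n * (A - r)) * exp (- r)"
    using assms(3,4) by (intro mult_left_mono) auto
  finally have "exp ((b - b') * (?n * x)) * exp (?n * (A' + r)) \<le> exp (?n * (A - r)) * exp (- r)" .
  moreover have "exp ((b - b') * (?n * x)) * Z u b' h n \<le> exp ((b - b') * (?n * x)) * exp (?n * (A' + r))"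
    using upper by (intro mult_left_mono) auto
  ultimately have "exp ((b - b') * (?n * x)) * Z u b' h n \<le> exp (?n * (A - r)) * exp (- r)"
    by linarith
  then have gap: "exp (?n * (A - r)) * (1 - exp (- r)) \<le> Z u b h n - exp ((b - b') * (?n * x)) * Z u b' h n"
    using lower by (simp add: right_diff_distrib)
  have "?n * (T + r) \<le> ?n * ((\<beta> - b) * x + (A - r))"
    using slope(2) by (intro mult_left_mono) auto
  then have "?n * (T + r) \<le> (\<beta> - b) * (?n * x) + ?n * (A - r)"
    by (simp add: algebra_simps)
  then have "exp (?n * (T + r)) \<le> exp ((\<beta> - b) * (?n * x)) * exp (?n * (A - r))"
    by (simp flip: exp_add)
  then have "(1 - exp (- r)) * exp (?n * (T + r))
      \<le> (1 - exp (- r)) * (exp ((\<beta> - b) * (?n * x)) * exp (?n * (A - r)))"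
    using assms(3) by (intro mult_left_mono) auto
  also have "\<dots> = exp ((\<beta> - b) * (?n * x)) * (exp (?n * (A - r)) * (1 - exp (- r)))"
    by simp
  also have "\<dots> \<le> exp ((\<beta> - b) * (?n * x)) * (Z u b h n - exp ((b - b') * (?n * x)) * Z u b' h n)"
    using gap by (intro mult_left_mono) auto
  also have "\<dots> \<le> Z u \<beta> h n"
    using assms(1,2) by (intro Z_ge_tangent_difference) auto
  finally show ?thesis .
qed

section \<open>Configurations of atypical magnetization\<close>

lemma sum_spins: "(\<Sum>i<n. real_of_int (\<sigma> ! i)) = real n * magnetization n \<sigma>"
  by (cases "n = 0") (auto simp: magnetization_def)

text \<open>An exponential Chebyshev inequality in the spins. The weight \<open>exp (l * e * \<Sum> \<sigma>\<^sub>i)\<close> merges with the external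
  field, which is why the bound is again a partition function.\<close>

lemma restricted_sum_le_tilted_Z:
  assumes "b > 0" "l \<ge> 0"
  shows "(\<Sum>\<sigma>\<in>{\<sigma> \<in> configs n. e * (magnetization n \<sigma> - m) > \<eta>}. exp (b * H u h n \<sigma>))
    \<le> exp (- (real n * (l * (e * m + \<eta>)))) * Z u b (h + e * l / b) n"
proof -
  have "exp (b * H u h n \<sigma>)
      \<le> exp (- (real n * (l * (e * m + \<eta>)))) * exp (b * H u (h + e * l / b) n \<sigma>)"
    if "e * (magnetization n \<sigma> - m) > \<eta>" for \<sigma>
  proof -
    have "b * H u (h + e * l / b) n \<sigma> = b * H u h n \<sigma> + real n * (l * (e * magnetization n \<sigma>))"
      unfolding H_def sum_spins using assms(1) by (simp add: field_simps)
    moreover have "real n * (l * (e * m + \<eta>)) \<le> real n * (l * (e * magnetization n \<sigma>))"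
      using that assms(2) by (intro mult_left_mono) (auto simp: algebra_simps)
    ultimately show ?thesis
      by (simp flip: exp_add)
  qed
  then have "(\<Sum>\<sigma>\<in>{\<sigma> \<in> configs n. e * (magnetization n \<sigma> - m) > \<eta>}. exp (b * H u h n \<sigma>))
    \<le> (\<Sum>\<sigma>\<in>{\<sigma> \<in> configs n. e * (magnetization n \<sigma> - m) > \<eta>}.
        exp (- (real n * (l * (e * m + \<eta>)))) * exp (b * H u (h + e * l / b) n \<sigma>))"
    by (intro sum_mono) auto
  also have "\<dots> \<le> (\<Sum>\<sigma>\<in>configs n.
        exp (- (real n * (l * (e * m + \<eta>)))) * exp (b * H u (h + e * l / b) n \<sigma>))"
    by (intro sum_mono2) auto
  finally show ?thesis
    unfolding Z_def sum_distrib_left .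
qed

lemma gibbs_eq: "gibbs u \<beta> h n P = (\<Sum>\<sigma>\<in>{\<sigma> \<in> configs n. P \<sigma>}. exp (\<beta> * H u h n \<sigma>)) / Z u \<beta> h n"
  by (simp add: gibbs_def gibbs_weight_def sum_divide_distrib)

lemma gibbs_nonneg: "gibbs u \<beta> h n P \<ge> 0"
  unfolding gibbs_eq by (intro divide_nonneg_pos sum_nonneg Z_pos) auto

lemma gibbs_le_1: "gibbs u \<beta> h n P \<le> 1"
proof -
  have "(\<Sum>\<sigma>\<in>{\<sigma> \<in> configs n. P \<sigma>}. exp (\<beta> * H u h n \<sigma>)) \<le> Z u \<beta> h n"
    unfolding Z_def by (intro sum_mono2) auto
  then show ?thesis
    unfolding gibbs_eq using Z_pos by (simp add: divide_le_eq_1)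
qed

lemma gibbs_subadditive:
  assumes "\<And>\<sigma>. P \<sigma> \<Longrightarrow> Q \<sigma> \<or> R \<sigma>"
  shows "gibbs u \<beta> h n P \<le> gibbs u \<beta> h n Q + gibbs u \<beta> h n R"
proof -
  let ?w = "gibbs_weight u \<beta> h n"
  have w: "?w \<sigma> \<ge> 0" for \<sigma>
    by (simp add: gibbs_weight_def less_imp_le[OF Z_pos])
  have "(\<Sum>\<sigma>\<in>{\<sigma> \<in> configs n. P \<sigma>}. ?w \<sigma>)
      \<le> (\<Sum>\<sigma>\<in>{\<sigma> \<in> configs n. Q \<sigma>} \<union> {\<sigma> \<in> configs n. R \<sigma>}. ?w \<sigma>)"
    using assms w by (intro sum_mono2) auto
  also have "\<dots> \<le> (\<Sum>\<sigma>\<in>{\<sigma> \<in> configs n. Q \<sigma>}. ?w \<sigma>) + (\<Sum>\<sigma>\<in>{\<sigma> \<in> configs n. R \<sigma>}. ?w \<sigma>)"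
    using w by (subst sum_Un) (auto intro: sum_nonneg)
  finally show ?thesis
    by (simp add: gibbs_def)
qed

lemma (in gaussian_tree) integrable_gibbs:
  "integrable M (\<lambda>\<omega>. gibbs (\<lambda>v. U v \<omega>) \<beta> h n P)"
proof (rule integrable_const_bound[of _ 1])
  have "(\<lambda>\<omega>. U (take i \<sigma>) \<omega>) \<in> borel_measurable M" if "\<sigma> \<in> configs n" "i \<in> {1..n}" for \<sigma> i
    using random_variable_U[OF take_in_vertices[OF that]] by simp
  then have "(\<lambda>\<omega>. H (\<lambda>v. U v \<omega>) h n \<sigma>) \<in> borel_measurable M" if "\<sigma> \<in> configs n" for \<sigma>
    unfolding H_def X_def using that by (intro borel_measurable_add borel_measurable_sum) auto
  then have "(\<lambda>\<omega>. \<Sum>\<sigma>\<in>{\<sigma> \<in> configs n. P \<sigma>}. exp (\<beta> * H (\<lambda>v. U v \<omega>) h n \<sigma>)) \<in> borel_measurable M"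
    by (intro borel_measurable_sum) auto
  then show "(\<lambda>\<omega>. gibbs (\<lambda>v. U v \<omega>) \<beta> h n P) \<in> borel_measurable M"
    unfolding gibbs_eq by measurable
qed (use gibbs_nonneg gibbs_le_1 in auto)

text \<open>Off three events of exponentially small probability, the numerator of the Gibbs weight is at most \<open>exp (n * T)\<close>
  and its denominator at least a constant times \<open>exp (n * (T + r))\<close>. The events are that Z at b is small, that Z at
  \<open>b'\<close> is large, and that Z at \<open>\<beta>\<^sub>c\<close> with the tilted field is large; on them the Gibbs weight is
  bounded by 1. The last two are estimated by Markov's inequality, applied directly to the pointwise bound.\<close>

lemma gibbs_one_sided_deviation:
  fixes h \<beta> \<eta> e :: real
  assumes beta: "\<beta> > beta_c h" and "\<eta> > 0"
  shows "\<exists>c>0. \<exists>C. \<forall>(M :: 'w measure) U n. gaussian_tree M U \<longrightarrow> n \<ge> 1 \<longrightarrow>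
    (\<integral>\<omega>. gibbs (\<lambda>v. U v \<omega>) \<beta> h n (\<lambda>\<sigma>. e * (magnetization n \<sigma> - m_star h) > \<eta>) \<partial>M)
      \<le> C * exp (- c * real n)"
proof -
  define bc where "bc = beta_c h"
  have bc: "bc > 0" "\<beta> > bc"
    using beta_c_pos[of h] beta by (auto simp: bc_def)
  have m: "m_star h = tanh (h * bc)"
    by (simp add: m_star_def bc_def mult.commute)
  obtain l where l: "l > 0" and tilt: "psi (h + e * l / bc) bc < psi h bc + l * (e * m_star h + \<eta>)"
    using exists_tilt[OF bc(1) \<open>\<eta> > 0\<close>, of h e] unfolding m by blast
  define \<delta> where "\<delta> = (psi h bc + l * (e * m_star h + \<eta>) - psi (h + e * l / bc) bc) / 2"
  have \<delta>: "\<delta> > 0"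
    using tilt by (simp add: \<delta>_def)
  define T where "T = (psi h bc - \<delta>) * (\<beta> / bc)"
  have "(psi h bc - \<delta>) * (\<beta> / bc) < psi h bc * (\<beta> / bc)"
    using bc \<delta> by (intro mult_strict_right_mono) auto
  then have "T < \<beta> * psi h bc / bc"
    by (simp add: T_def mult.commute)
  then obtain b' b x r where b: "0 < b" "b < bc" "b' < b" and r: "0 < r"
    and slope: "psi h b' + (b - b') * x + 3 * r \<le> psi h b" "T + 2 * r \<le> (\<beta> - b) * x + psi h b"
    using exists_slope_below_beta_c[OF beta, of T] unfolding bc_def by blast
  obtain c1 C1 where c1: "c1 > 0" and lower: "\<And>(M :: 'w measure) U n. gaussian_tree M U \<Longrightarrow>
    (\<integral>\<omega>. indicator {..<exp (real n * (psi h b - r))} (Z (\<lambda>v. U v \<omega>) b h n) \<partial>M)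
      \<le> (C1 * exp (- c1 * real n) :: real)"
    using Z_lower_deviation[of b h r, where 'w = 'w] b r unfolding bc_def by blast
  define \<kappa> where "\<kappa> = 1 - exp (- r)"
  have \<kappa>: "\<kappa> > 0"
    using r by (simp add: \<kappa>_def)
  define c where "c = min c1 (min r \<delta>)"
  have c: "c > 0" "c \<le> c1" "c \<le> r" "c \<le> \<delta>"
    using c1 r \<delta> by (auto simp: c_def)
  define C where "C = \<bar>C1\<bar> + 1 + 1 + 1 / \<kappa>"
  have "(\<integral>\<omega>. gibbs (\<lambda>v. U v \<omega>) \<beta> h n (\<lambda>\<sigma>. e * (magnetization n \<sigma> - m_star h) > \<eta>) \<partial>M)
      \<le> C * exp (- c * real n)"
    if tree: "gaussian_tree M U" and n: "n \<ge> 1" for M :: "'w measure" and U n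
  proof -
    interpret gaussian_tree M U by fact
    let ?n = "real n"
    let ?h = "h + e * l / bc"
    define a1 where "a1 = ?n * (psi h b' + r)"
    define a2 where "a2 = ?n * (psi h bc - \<delta> + l * (e * m_star h + \<eta>))"
    define G where "G u = gibbs u \<beta> h n (\<lambda>\<sigma>. e * (magnetization n \<sigma> - m_star h) > \<eta>)" for u
    define J where "J u = (indicator {..<exp (?n * (psi h b - r))} (Z u b h n) :: real)" for u
    have J_int: "integrable M (\<lambda>\<omega>. J (\<lambda>v. U v \<omega>))"
      unfolding J_def by (rule integrable_const_bound[of _ 1]) auto
    have le: "G u \<le> J u + Z u b' h n * exp (- a1) + Z u bc ?h n * exp (- a2) + exp (- (?n * r)) / \<kappa>" for u
    proof -
      have nonneg: "J u \<ge> 0" "Z u b' h n * exp (- a1) \<ge> 0" "Z u bc ?h n * exp (- a2) \<ge> 0"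
        "exp (- (?n * r)) / \<kappa> \<ge> 0"
        using \<kappa> by (auto simp: J_def less_imp_le[OF Z_pos])
      have G1: "G u \<le> 1"
        by (simp add: G_def gibbs_le_1)
      have large: "1 \<le> z * exp (- a)" if "z > exp a" for z a :: real
        using that by (simp add: exp_minus field_simps)
      consider "Z u b h n < exp (?n * (psi h b - r))" | "Z u b' h n > exp a1" | "Z u bc ?h n > exp a2"
        | (typical) "exp (?n * (psi h b - r)) \<le> Z u b h n" "Z u b' h n \<le> exp a1" "Z u bc ?h n \<le> exp a2"
        by linarith
      then show ?thesis
      proof cases
        case 1
        then have "J u = 1"
          by (simp add: J_def)
        then show ?thesis
          using G1 nonneg by linarith
      next
        case 2
        then show ?thesis
          using G1 nonneg large[OF 2] by linarith
      next
        case 3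
        then show ?thesis
          using G1 nonneg large[OF 3] by linarith
      next
        case typical
        let ?B = "{\<sigma> \<in> configs n. e * (magnetization n \<sigma> - m_star h) > \<eta>}"
        have "(\<Sum>\<sigma>\<in>?B. exp (bc * H u h n \<sigma>))
            \<le> exp (- (?n * (l * (e * m_star h + \<eta>)))) * Z u bc ?h n"
          using bc(1) l by (intro restricted_sum_le_tilted_Z) auto
        also have "\<dots> \<le> exp (- (?n * (l * (e * m_star h + \<eta>)))) * exp a2"
          using typical(3) by (intro mult_left_mono) auto
        also have "\<dots> = exp (?n * (psi h bc - \<delta>))"
          by (simp add: a2_def distrib_left flip: exp_add)
        finally have restricted: "(\<Sum>\<sigma>\<in>?B. exp (bc * H u h n \<sigma>)) \<le> exp (?n * (psi h bc - \<delta>))" .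
        \<comment> \<open>Passing from the critical inverse temperature to \<beta> raises each weight to the power \<beta> / bc \<ge> 1.\<close>
        have "(\<Sum>\<sigma>\<in>?B. exp (\<beta> * H u h n \<sigma>)) = (\<Sum>\<sigma>\<in>?B. exp (bc * H u h n \<sigma>) powr (\<beta> / bc))"
          using bc by (intro sum.cong) (auto simp: powr_def)
        also have "\<dots> \<le> (\<Sum>\<sigma>\<in>?B. exp (bc * H u h n \<sigma>)) powr (\<beta> / bc)"
          using bc by (intro sum_powr_le_powr_sum) auto
        also have "\<dots> \<le> exp (?n * (psi h bc - \<delta>)) powr (\<beta> / bc)"
          using restricted bc by (intro powr_mono2) (auto intro: sum_nonneg)
        also have "\<dots> = exp (?n * T)"
          by (simp add: powr_def T_def mult_ac)
        finally have num: "(\<Sum>\<sigma>\<in>?B. exp (\<beta> * H u h n \<sigma>)) \<le> exp (?n * T)" .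
        have den: "\<kappa> * exp (?n * (T + r)) \<le> Z u \<beta> h n"
          unfolding \<kappa>_def
          using typical b bc(2) r n slope
          by (intro Z_ge_of_tangent_slope[of b' b \<beta> r n "psi h b" u h "psi h b'" x T]) (auto simp: a1_def)
        have "G u \<le> exp (?n * T) / (\<kappa> * exp (?n * (T + r)))"
          unfolding G_def gibbs_eq using num den \<kappa> by (intro frac_le) auto
        also have "\<dots> = exp (- (?n * r)) / \<kappa>"
          using \<kappa> by (simp add: distrib_left exp_add exp_minus field_simps)
        finally show ?thesis
          using nonneg by linarith
      qed
    qed
    have "expectation (\<lambda>\<omega>. G (\<lambda>v. U v \<omega>))
      \<le> expectation (\<lambda>\<omega>. J (\<lambda>v. U v \<omega>) + Z (\<lambda>v. U v \<omega>) b' h n * exp (- a1)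
          + Z (\<lambda>v. U v \<omega>) bc ?h n * exp (- a2) + exp (- (?n * r)) / \<kappa>)"
      using J_int expectation_Z(1)[OF tree]
      by (intro integral_mono le) (auto simp: G_def integrable_gibbs)
    also have "\<dots> = expectation (\<lambda>\<omega>. J (\<lambda>v. U v \<omega>)) + exp (?n * psi h b') * exp (- a1)
        + exp (?n * psi ?h bc) * exp (- a2) + exp (- (?n * r)) / \<kappa>"
      using J_int expectation_Z[OF tree] by (simp add: prob_space)
    also have "exp (?n * psi h b') * exp (- a1) = exp (- (?n * r))"
      by (simp add: a1_def distrib_left flip: exp_add)
    also have "exp (?n * psi ?h bc) * exp (- a2) = exp (- (?n * \<delta>))"
    proof -
      have "psi ?h bc - (psi h bc - \<delta> + l * (e * m_star h + \<eta>)) = - \<delta>"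
        by (simp add: \<delta>_def field_simps)
      from arg_cong[OF this, of "\<lambda>t. ?n * t"] show ?thesis
        by (simp add: a2_def right_diff_distrib flip: exp_add)
    qed
    also have "expectation (\<lambda>\<omega>. J (\<lambda>v. U v \<omega>)) \<le> \<bar>C1\<bar> * exp (- (?n * c1))"
    proof -
      have "expectation (\<lambda>\<omega>. J (\<lambda>v. U v \<omega>)) \<le> C1 * exp (- (?n * c1))"
        using lower[OF tree, of n] by (simp add: J_def mult.commute)
      also have "\<dots> \<le> \<bar>C1\<bar> * exp (- (?n * c1))"
        by (intro mult_right_mono) auto
      finally show ?thesis .
    qed
    also have "\<bar>C1\<bar> * exp (- (?n * c1)) + exp (- (?n * r)) + exp (- (?n * \<delta>)) + exp (- (?n * r)) / \<kappa>
        \<le> \<bar>C1\<bar> * exp (- (?n * c)) + exp (- (?n * c)) + exp (- (?n * c)) + exp (- (?n * c)) / \<kappa>"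
      using c \<kappa> by (intro add_mono mult_left_mono divide_right_mono) (auto intro: mult_left_mono)
    also have "\<dots> = C * exp (- c * ?n)"
      by (simp add: C_def algebra_simps)
    finally show ?thesis
      by (simp add: G_def)
  qed
  then show ?thesis
    using c(1) by blast
qed

section \<open>From exponential decay of expectations to almost sure convergence\<close>

text \<open>The expectations are summable, so the sum of the f n has finite expectation and is finite almost surely.\<close>

lemma AE_tendsto_0_of_exponential_expectation:
  fixes f :: "nat \<Rightarrow> 'a \<Rightarrow> real"
  assumes int: "\<And>n. integrable M (f n)" and nonneg: "\<And>n \<omega>. f n \<omega> \<ge> 0"
    and le: "\<And>n. n \<ge> 1 \<Longrightarrow> (\<integral>\<omega>. f n \<omega> \<partial>M) \<le> C * exp (- c * real n)" and "c > 0"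
  shows "AE \<omega> in M. (\<lambda>n. f n \<omega>) \<longlonglongrightarrow> 0"
proof -
  let ?a = "\<lambda>n. \<integral>\<omega>. f (Suc n) \<omega> \<partial>M"
  have a_nonneg: "?a n \<ge> 0" for n
    using nonneg by (intro integral_nonneg_AE) auto
  have "summable (\<lambda>n. C * exp (- c) * exp (- c) ^ n)"
    using \<open>c > 0\<close> by (intro summable_mult summable_geometric) simp
  moreover have "norm (?a n) \<le> C * exp (- c) * exp (- c) ^ n" for n
    using le[of "Suc n"] a_nonneg[of n]
    by (simp add: algebra_simps flip: exp_of_nat_mult exp_add)
  ultimately have "summable ?a"
    by (rule summable_comparison_test'[where N = 0])
  then have "(\<Sum>n. ennreal (?a n)) \<noteq> \<top>"
    by (rule ennreal_suminf_neq_top[OF _ a_nonneg])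
  moreover have meas: "(\<lambda>\<omega>. \<Sum>n. ennreal (f (Suc n) \<omega>)) \<in> borel_measurable M"
    using int by (intro borel_measurable_suminf_order) auto
  moreover have "(\<integral>\<^sup>+\<omega>. (\<Sum>n. ennreal (f (Suc n) \<omega>)) \<partial>M) = (\<Sum>n. ennreal (?a n))"
    using int nonneg by (subst nn_integral_suminf) (auto simp: nn_integral_eq_integral)
  ultimately have "AE \<omega> in M. (\<Sum>n. ennreal (f (Suc n) \<omega>)) \<noteq> \<top>"
    using nn_integral_PInf_AE[OF meas] by (simp add: infinity_ennreal_def)
  then show ?thesis
  proof eventually_elim
    case (elim \<omega>)
    then have "summable (\<lambda>n. f (Suc n) \<omega>)"
      using nonneg by (intro summable_suminf_not_top) auto
    then show ?case
      by (intro LIMSEQ_imp_Suc[of "\<lambda>n. f n \<omega>"] summable_LIMSEQ_zero)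
  qed
qed

theorem theorem1:
  fixes h \<beta> \<eta> :: real
  assumes "h > 0" and "\<beta> > beta_c h" and "\<eta> > 0"
  shows "\<exists>c>0. \<exists>C::real. \<forall>(M :: 'w measure) U. gaussian_tree M U \<longrightarrow>
    ((\<lambda>n. prob_space.expectation M (\<lambda>\<omega>.
        gibbs (\<lambda>v. U v \<omega>) \<beta> h n (\<lambda>\<sigma>. \<bar>magnetization n \<sigma> - m_star h\<bar> > \<eta>)))
      \<longlonglongrightarrow> 0) \<and>
    (\<forall>n\<ge>1. prob_space.expectation M (\<lambda>\<omega>.
        gibbs (\<lambda>v. U v \<omega>) \<beta> h n (\<lambda>\<sigma>. \<bar>magnetization n \<sigma> - m_star h\<bar> > \<eta>))
      \<le> C * exp (- c * real n)) \<and>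
    (AE \<omega> in M. (\<lambda>n.
        gibbs (\<lambda>v. U v \<omega>) \<beta> h n (\<lambda>\<sigma>. \<bar>magnetization n \<sigma> - m_star h\<bar> > \<eta>))
      \<longlonglongrightarrow> 0)"
proof -
  obtain c1 C1 where c1: "c1 > 0" and up: "\<And>(M :: 'w measure) U n. gaussian_tree M U \<Longrightarrow> n \<ge> 1 \<Longrightarrow>
    (\<integral>\<omega>. gibbs (\<lambda>v. U v \<omega>) \<beta> h n (\<lambda>\<sigma>. 1 * (magnetization n \<sigma> - m_star h) > \<eta>) \<partial>M)
      \<le> C1 * exp (- c1 * real n)"
    using gibbs_one_sided_deviation[OF assms(2,3), of 1, where 'w = 'w] by blast
  obtain c2 C2 where c2: "c2 > 0" and down: "\<And>(M :: 'w measure) U n. gaussian_tree M U \<Longrightarrow> n \<ge> 1 \<Longrightarrow>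
    (\<integral>\<omega>. gibbs (\<lambda>v. U v \<omega>) \<beta> h n (\<lambda>\<sigma>. - 1 * (magnetization n \<sigma> - m_star h) > \<eta>) \<partial>M)
      \<le> C2 * exp (- c2 * real n)"
    using gibbs_one_sided_deviation[OF assms(2,3), of "- 1", where 'w = 'w] by blast
  define c where "c = min c1 c2"
  define C where "C = \<bar>C1\<bar> + \<bar>C2\<bar>"
  have c: "c > 0" "c \<le> c1" "c \<le> c2"
    using c1 c2 by (auto simp: c_def)
  have main: "(\<lambda>n. \<integral>\<omega>. F n \<omega> \<partial>M) \<longlonglongrightarrow> 0" "\<And>n. n \<ge> 1 \<Longrightarrow> (\<integral>\<omega>. F n \<omega> \<partial>M) \<le> C * exp (- c * real n)"
      "AE \<omega> in M. (\<lambda>n. F n \<omega>) \<longlonglongrightarrow> 0"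
    if tree: "gaussian_tree M U" and F: "F = (\<lambda>n \<omega>. gibbs (\<lambda>v. U v \<omega>) \<beta> h n (\<lambda>\<sigma>. \<bar>magnetization n \<sigma> - m_star h\<bar> > \<eta>))"
    for M :: "'w measure" and U F
  proof -
    interpret gaussian_tree M U by fact
    show bound: "(\<integral>\<omega>. F n \<omega> \<partial>M) \<le> C * exp (- c * real n)" if n: "n \<ge> 1" for n
    proof -
      let ?G = "\<lambda>e \<omega>. gibbs (\<lambda>v. U v \<omega>) \<beta> h n (\<lambda>\<sigma>. e * (magnetization n \<sigma> - m_star h) > \<eta>)"
      have "expectation (F n) \<le> expectation (\<lambda>\<omega>. ?G 1 \<omega> + ?G (- 1) \<omega>)"
        unfolding F
        by (intro integral_mono gibbs_subadditive Bochner_Integration.integrable_add integrable_gibbs) auto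
      also have "\<dots> = expectation (?G 1) + expectation (?G (- 1))"
        by (intro Bochner_Integration.integral_add integrable_gibbs)
      also have "\<dots> \<le> C1 * exp (- c1 * real n) + C2 * exp (- c2 * real n)"
        by (intro add_mono up[OF tree n] down[OF tree n])
      also have "\<dots> \<le> \<bar>C1\<bar> * exp (- c * real n) + \<bar>C2\<bar> * exp (- c * real n)"
        using c by (intro add_mono mult_mono) (auto intro: mult_right_mono)
      finally show ?thesis
        by (simp add: C_def distrib_right)
    qed
    have "(\<lambda>n. C * exp (- c) ^ n) \<longlonglongrightarrow> C * 0"
      using c(1) by (intro tendsto_mult tendsto_const LIMSEQ_power_zero) simp
    then have lim: "(\<lambda>n. C * exp (- c * real n)) \<longlonglongrightarrow> 0"
      by (simp add: mult.commute flip: exp_of_nat_mult)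
    have nonneg: "F n \<omega> \<ge> 0" for n \<omega>
      by (simp add: F gibbs_nonneg)
    show "(\<lambda>n. expectation (F n)) \<longlonglongrightarrow> 0"
      by (rule tendsto_sandwich[OF _ _ tendsto_const lim])
         (use bound in \<open>auto intro!: eventually_sequentiallyI[of 1] integral_nonneg_AE nonneg\<close>)
    show "AE \<omega> in M. (\<lambda>n. F n \<omega>) \<longlonglongrightarrow> 0"
      by (rule AE_tendsto_0_of_exponential_expectation[OF _ nonneg bound c(1)])
         (auto simp: F integrable_gibbs)
  qed
  show ?thesis
    using c(1) main[OF _ refl] by blast
qed

end
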